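(* Let $m,n,N$ be positive integers such that $m-n$ and $N$ are even and $0\le m-n\le N$. Let $\boldsymbol u=(u_1,\dots,u_m)$ be an $m$-vertex and $S^0=\{v_1<\cdots<v_n\}$ an $n$-vertex in an acyclic digraph $D$. Let $S=\{V_1<\cdots<V_N\}$ be a finite totally ordered set of vertices which is disjoint from $S^0$. Let $A=(a_{V_iV_j})$ be an $N\times N$ nonsingular skew-symmetric matrix with rows and columns indexed by $S$, with copfaffian matrix $\widehat A$. Then $$\sum_{I\in\binom S{m-n}}\operatorname{Pf}(A^I_I)\sum_{\pi\in S_m}\operatorname{sgn}(\pi)\,F^0(\boldsymbol u^\pi,S^0\uplus I)=\operatorname{Pf}(A)\operatorname{Pf}\begin{pmatrix}O_m&H(\boldsymbol u;S)J_N&H(\boldsymbol u;S^0)J_n\\-J_N\,{}^tH(\boldsymbol u;S)&\frac1{\operatorname{Pf}(A)}J_N\,{}^t\widehat A\,J_N&O_{N,n}\\-J_n\,{}^tH(\boldsymbol u;S^0)&O_{n,N}&O_n\end{pmatrix},$$ where $H(\boldsymbol u;S^0)=(h(u_i,v_j))_{1\le i\le m,1\le j\le n}$ and $H(\boldsymbol u;S)=(h(u_i,V_j))_{1\le i\le m,1\le j\le N}$. In particular, if $\boldsymbol u$ is $D$-compatible with $S^0\uplus S$, then $$\sum_{I\in\binom S{m-n}}\operatorname{Pf}(A^I_I)\,F^0(\boldsymbol u,S^0\uplus I)=\operatorname{Pf}(A)\operatorname{Pf}\begin{pmatrix}O_m&H(\boldsymbol u;S)J_N&H(\boldsymbol u;S^0)J_n\\-J_N\,{}^tH(\boldsymbol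 u;S)&\frac1{\operatorname{Pf}(A)}J_N\,{}^t\widehat A\,J_N&O_{N,n}\\-J_n\,{}^tH(\boldsymbol u;S^0)&O_{n,N}&O_n\end{pmatrix}.$$
   Context: $D=(V,E)$ is an acyclic digraph without multiple edges, with only finitely many directed paths between any two vertices. For vertices $u,v$, $\mathcal P(u,v)$ is the set of directed paths from $u$ to $v$. Each edge $e$ carries a commutative indeterminate $x_e$ as weight; the weight of a path is the product of the weights of its edges, and $h(u,v)=\sum_{P\in\mathcal P(u,v)}\operatorname{wt}(P)$. An $n$-vertex is an $n$-tuple of vertices. For $n$-vertices $\boldsymbol u,\boldsymbol v$, an $n$-path from $\boldsymbol u$ to $\boldsymbol v$ is $(P_1,\dots,P_n)$ with $P_i\in\mathcal P(u_i,v_i)$; its weight is the product of the weights of the $P_i$; it is non-intersecting if $P_i$ and $P_j$ share no vertex for all $i\ne j$. $F^0(\boldsymbol u,\boldsymbol v)$ is the sum of the weights of all non-intersecting $n$-paths from $\boldsymbol u$ to $\boldsymbol v$. For a permutation $\pi$, $\boldsymbol u^\pi=(u_{\pi(1)},\dots,u_{\pi(n)})$. A finite totally ordered set of vertices is regarded as the tuple of its elements in increasing order. For $I\subseteq S$, $S^0\uplus I$ is the union of $S^0$ and $I$, ordered so that every element of $S^0$ precedes every element of $I$. A tuple $(u_1,\dots,u_m)$ is $D$-compatible with a tuple $(w_1,\dots,w_p)$ if every path in $\mathcal P(u_i,w_l)$ intersects (shares a vertex with) every path in $\mathcal P(u_j,w_k)$ whenever $i<j$ and $k<l$. $\binom Sk$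 is the set of $k$-element subsets of $S$; $S_m$ (in $\pi\in S_m$) is the symmetric group. $A^I_I$ is the submatrix of $A$ with rows and columns indexed by $I$. $\operatorname{Pf}$ is the Pfaffian of a skew-symmetric matrix of even size, normalized by $\operatorname{Pf}\begin{pmatrix}0&a\\-a&0\end{pmatrix}=a$ (empty Pfaffian $=1$). The copfaffian matrix $\widehat A$ of a skew-symmetric $A$ of even size $N$ is the skew-symmetric matrix with $(i,j)$ entry, for $i<j$, equal to $(-1)^{i+j-1}$ times the Pfaffian of $A$ with rows and columns $i,j$ removed. $J_N$ is the $N\times N$ matrix with ones on the antidiagonal and zeros elsewhere, $O_{p,q}$ the $p\times q$ zero matrix, $O_p=O_{p,p}$, ${}^tX$ the transpose. *)

theory Defs
  imports
    "Graph_Theory.Graph_Theory"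
    "Jordan_Normal_Form.Determinant"
    "Jordan_Normal_Form.DL_Submatrix"
    "HOL-Library.Poly_Mapping"
    "HOL-Combinatorics.List_Permutation"
begin

section \<open>Polynomials in the edge indeterminates\<close>

text \<open>
  Polynomials over a coefficient ring \<open>'k\<close> in indeterminates indexed by \<open>'e\<close>, represented as
  finitely supported functions from monomials (finitely supported exponent functions) to
  coefficients; multiplication on \<open>\<Rightarrow>\<^sub>0\<close> is convolution.
\<close>

type_synonym ('e, 'k) mpol = "('e \<Rightarrow>\<^sub>0 nat) \<Rightarrow>\<^sub>0 'k"

definition const :: "'k::zero \<Rightarrow> ('e, 'k) mpol" where
  "const c = Poly_Mapping.single 0 c"

definition indet :: "'e \<Rightarrow> ('e, 'k::zero_neq_one) mpol" where
  "indet e = Poly_Mapping.single (Poly_Mapping.single e 1) 1"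

section \<open>Path generating functions\<close>

text \<open>
  Tuples of vertices are lists. A finite totally ordered set of vertices is the distinct list of
  its elements in increasing order. Tuple positions are counted from 0.
\<close>

definition paths :: "('v, 'e) pre_digraph \<Rightarrow> 'v \<Rightarrow> 'v \<Rightarrow> 'e list set" where
  "paths D u v = {p. pre_digraph.apath D u p v}"

definition acyclic_digraph :: "('v, 'e) pre_digraph \<Rightarrow> bool" where
  "acyclic_digraph D \<longleftrightarrow> (\<nexists>c. pre_digraph.cycle D c)"

text \<open>A path is a list of arcs; the start vertex is needed to recover the vertices of an empty path.\<close>

definition path_verts :: "('v, 'e) pre_digraph \<Rightarrow> 'v \<Rightarrow> 'e list \<Rightarrow> 'v set" where
  "path_verts D u p = set (pre_digraph.awalk_verts D u p)"

definition path_wt :: "('e \<Rightarrow> 'r::comm_ring_1) \<Rightarrow> 'e list \<Rightarrow> 'r" where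
  "path_wt x p = (\<Prod>e\<leftarrow>p. x e)"

definition h :: "('v, 'e) pre_digraph \<Rightarrow> ('e \<Rightarrow> 'r::comm_ring_1) \<Rightarrow> 'v \<Rightarrow> 'v \<Rightarrow> 'r" where
  "h D x u v = (\<Sum>p\<in>paths D u v. path_wt x p)"

definition H :: "('v, 'e) pre_digraph \<Rightarrow> ('e \<Rightarrow> 'r::comm_ring_1) \<Rightarrow> 'v list \<Rightarrow> 'v list \<Rightarrow> 'r mat" where
  "H D x us vs = mat (length us) (length vs) (\<lambda>(i, j). h D x (us ! i) (vs ! j))"

definition n_paths :: "('v, 'e) pre_digraph \<Rightarrow> 'v list \<Rightarrow> 'v list \<Rightarrow> 'e list list set" where
  "n_paths D us vs =
     {P. length P = length us \<and> (\<forall>i<length us. P ! i \<in> paths D (us ! i) (vs ! i))}"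

definition n_path_wt :: "('e \<Rightarrow> 'r::comm_ring_1) \<Rightarrow> 'e list list \<Rightarrow> 'r" where
  "n_path_wt x P = (\<Prod>p\<leftarrow>P. path_wt x p)"

definition non_intersecting :: "('v, 'e) pre_digraph \<Rightarrow> 'v list \<Rightarrow> 'e list list \<Rightarrow> bool" where
  "non_intersecting D us P \<longleftrightarrow>
     (\<forall>i<length us. \<forall>j<length us. i \<noteq> j \<longrightarrow>
        path_verts D (us ! i) (P ! i) \<inter> path_verts D (us ! j) (P ! j) = {})"

definition F0 :: "('v, 'e) pre_digraph \<Rightarrow> ('e \<Rightarrow> 'r::comm_ring_1) \<Rightarrow> 'v list \<Rightarrow> 'v list \<Rightarrow> 'r" where
  "F0 D x us vs = (\<Sum>P\<in>{P \<in> n_paths D us vs. non_intersecting D us P}. n_path_wt x P)"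

definition D_compatible :: "('v, 'e) pre_digraph \<Rightarrow> 'v list \<Rightarrow> 'v list \<Rightarrow> bool" where
  "D_compatible D us ws \<longleftrightarrow>
     (\<forall>i j k l. i < j \<and> j < length us \<and> k < l \<and> l < length ws \<longrightarrow>
        (\<forall>p\<in>paths D (us ! i) (ws ! l). \<forall>q\<in>paths D (us ! j) (ws ! k).
           path_verts D (us ! i) p \<inter> path_verts D (us ! j) q \<noteq> {}))"

text \<open>For a subset \<open>I\<close> of an ordered set \<open>S\<close>: its elements in increasing order, and their positions in \<open>S\<close>.\<close>

definition ordered_subset :: "'v list \<Rightarrow> 'v set \<Rightarrow> 'v list" where
  "ordered_subset S I = filter (\<lambda>v. v \<in> I) S"

definition positions :: "'v list \<Rightarrow> 'v set \<Rightarrow> nat set" where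
  "positions S I = {i. i < length S \<and> S ! i \<in> I}"

section \<open>Pfaffians\<close>

text \<open>The diagonal condition only matters in characteristic 2.\<close>

definition skew_symmetric :: "'a::comm_ring_1 mat \<Rightarrow> bool" where
  "skew_symmetric A \<longleftrightarrow>
     square_mat A \<and> transpose_mat A = - A \<and> (\<forall>i<dim_row A. A $$ (i, i) = 0)"

text \<open>
  A perfect matching of \<open>{0..<2n}\<close> is encoded by the unique permutation \<open>\<sigma>\<close> listing its pairs
  \<open>{\<sigma>(2i), \<sigma>(2i+1)}\<close> with increasing pairs and increasing first elements; \<open>pf\<close> is the signed
  sum over perfect matchings. It is only used for matrices of even size.
\<close>

definition matching_perms :: "nat \<Rightarrow> (nat \<Rightarrow> nat) set" where
  "matching_perms n = {\<sigma>. \<sigma> permutes {..<2 * n} \<and>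
     (\<forall>i<n. \<sigma> (2 * i) < \<sigma> (2 * i + 1)) \<and>
     (\<forall>i. i + 1 < n \<longrightarrow> \<sigma> (2 * i) < \<sigma> (2 * (i + 1)))}"

definition pf :: "'a::comm_ring_1 mat \<Rightarrow> 'a" where
  "pf A = (let n = dim_row A div 2 in
     \<Sum>\<sigma>\<in>matching_perms n. of_int (sign \<sigma>) * (\<Prod>i<n. A $$ (\<sigma> (2 * i), \<sigma> (2 * i + 1))))"

text \<open>The exponent is \<open>i + j - 1\<close> for the row and column numbers counted from 1.\<close>

definition copfaffian :: "'a::comm_ring_1 mat \<Rightarrow> 'a mat" where
  "copfaffian A =
     (let c = (\<lambda>i j. (- 1) ^ (Suc i + Suc j - 1) * pf (submatrix A (- {i, j}) (- {i, j})))
      in mat (dim_row A) (dim_row A) (\<lambda>(i, j).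
           if i < j then c i j else if j < i then - c j i else 0))"

definition antidiag_mat :: "nat \<Rightarrow> 'a::comm_ring_1 mat" where
  "antidiag_mat n = mat n n (\<lambda>(i, j). if i + j + 1 = n then 1 else 0)"

text \<open>
  The matrix with block rows \<open>(A11, A12, A13)\<close>, \<open>(A21, A22, A23)\<close>, \<open>(A31, A32, A33)\<close>. The inner
  blocks of height or width 0 make \<open>four_block_mat\<close> a plain horizontal or vertical juxtaposition.
\<close>

definition nine_block_mat ::
  "'a::zero mat \<Rightarrow> 'a mat \<Rightarrow> 'a mat \<Rightarrow> 'a mat \<Rightarrow> 'a mat \<Rightarrow> 'a mat \<Rightarrow> 'a mat \<Rightarrow> 'a mat \<Rightarrow> 'a mat \<Rightarrow> 'a mat"
where
  "nine_block_mat A11 A12 A13 A21 A22 A23 A31 A32 A33 =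
     four_block_mat
       A11
       (four_block_mat A12 A13 (0\<^sub>m 0 (dim_col A12)) (0\<^sub>m 0 (dim_col A13)))
       (A21 @\<^sub>r A31)
       (four_block_mat A22 A23 A32 A33)"

end

theory Submission
  imports Defs
begin

text \<open>
  The Pfaffian of a word over an alphabet with an alternating form is an alternating multilinear
  function of its letters. Row operations clear the off-diagonal blocks \<open>H J\<^sub>N\<close> against the middle block,
  which is a reordering of the inverse of \<open>A\<close>: its Pfaffian \<open>1 / Pf A\<close> splits off, and the upper
  left block becomes \<open>H A H\<^sup>t\<close>. Expanding the remaining Pfaffian multilinearly in the rows of
  \<open>H(u; S)\<close> and \<open>H(u; S\<^sup>0)\<close> and collecting rearrangements of the same letters (Cauchy--Binet) gives
  the sum of \<open>Pf A\<^sub>I\<^sub>I det H(u; S\<^sup>0 \<uplus> I)\<close>. These determinants are signed counts of non-intersecting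
  paths by the Lindstroem--Gessel--Viennot involution.
\<close>

section \<open>The Pfaffian of a word\<close>

text \<open>Labelling rows by letters separates a row from its position: reordering rows and
  adjoining vectors that are not rows of the given matrix happen inside one fixed alternating form,
  and only the word changes. The antidiagonal factors say that the letters for S and S0 are read in
  decreasing order. Dual letters then sit nested around an even word, and each dual pair splits off
  the factor 1 with no sign to track. The transposition of the copfaffian matrix has a similar
  origin: A times its copfaffian matrix is -Pf(A) times the identity, and transposing a
  skew-symmetric matrix supplies the missing minus. Two constraints shape the argument. The field
  may have characteristic 2, so the vanishing on equal letters is proved by cancelling terms in
  pairs, never from x = -x. The entries of the block matrix are polynomials, so the word identities
  are proved over arbitrary commutative rings, with a product of two Pfaffians equal to 1 in place
  of a division.\<close>

definition delete_nth :: "nat \<Rightarrow> 'a list \<Rightarrow> 'a list" where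
  "delete_nth i xs = take i xs @ drop (Suc i) xs"

lemma length_delete_nth: "i < length xs \<Longrightarrow> length (delete_nth i xs) = length xs - 1"
  by (simp add: delete_nth_def)

lemma set_delete_nth: "set (delete_nth i xs) \<subseteq> set xs"
  by (auto simp: delete_nth_def dest: in_set_takeD in_set_dropD)

lemma delete_nth_0 [simp]: "delete_nth 0 (x # xs) = xs"
  and delete_nth_Suc [simp]: "delete_nth (Suc i) (x # xs) = x # delete_nth i xs"
  by (simp_all add: delete_nth_def)

lemma delete_nth_append:
  "delete_nth i (xs @ ys) =
    (if i < length xs then delete_nth i xs @ ys else xs @ delete_nth (i - length xs) ys)"
  by (simp add: delete_nth_def Suc_diff_le)

lemma delete_nth_map: "delete_nth i (map f xs) = map f (delete_nth i xs)"
  by (simp add: delete_nth_def take_map drop_map)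

lemma nth_delete_nth:
  "j < length xs - 1 \<Longrightarrow> delete_nth i xs ! j = (if j < i then xs ! j else xs ! Suc j)"
  by (auto simp: delete_nth_def nth_append)

lemma delete_nth_commute:
  "j < i \<Longrightarrow> i < length xs \<Longrightarrow>
    delete_nth j (delete_nth i xs) = delete_nth (i - 1) (delete_nth j xs)"
  by (rule nth_equalityI) (auto simp: length_delete_nth nth_delete_nth)

text \<open>
  The Pfaffian of the matrix with entries \<open>w x y\<close>, \<open>x\<close> and \<open>y\<close> running through the letters of the
  word, by expansion along the first row; it is \<open>0\<close> for words of odd length.
\<close>

fun pfw :: "('a \<Rightarrow> 'a \<Rightarrow> 'r::comm_ring_1) \<Rightarrow> 'a list \<Rightarrow> 'r" where
  "pfw w [] = 1"
| "pfw w (x # xs) =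
    (\<Sum>i<length xs. (- 1) ^ i * w x (xs ! i) * pfw w (take i xs @ drop (Suc i) xs))"

lemma pfw_Cons:
  "pfw w (x # xs) = (\<Sum>i<length xs. (- 1) ^ i * w x (xs ! i) * pfw w (delete_nth i xs))"
  by (simp add: delete_nth_def)

declare pfw.simps(2) [simp del]

lemma pfw_map: "pfw w (map f xs) = pfw (\<lambda>x y. w (f x) (f y)) xs"
proof (induction xs rule: length_induct)
  case (1 xs)
  show ?case
  proof (cases xs)
    case (Cons y ys)
    show ?thesis
      unfolding Cons list.map pfw_Cons delete_nth_map
      by (intro sum.cong) (auto simp: Cons 1 length_delete_nth)
  qed simp
qed

lemma pfw_cong:
  assumes "\<And>x y. x \<in> set xs \<Longrightarrow> y \<in> set xs \<Longrightarrow> w x y = w' x y"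
  shows "pfw w xs = pfw w' xs"
  using assms
proof (induction xs rule: length_induct)
  case (1 xs)
  show ?case
  proof (cases xs)
    case (Cons y ys)
    have "pfw w (delete_nth i ys) = pfw w' (delete_nth i ys)" if "i < length ys" for i
      using that Cons 1(2) set_delete_nth[of i ys] 
      by (intro 1(1)[rule_format]) (auto simp: length_delete_nth)
    then show ?thesis
      unfolding Cons list.map pfw_Cons 
      by (intro sum.cong) (auto simp: Cons 1)
  qed simp
qed

lemma pfw_hom:
  assumes "f 0 = 0" "f 1 = 1" "\<And>x y. f (x + y) = f x + f y" "\<And>x y. f (x * y) = f x * f y"
  shows "f (pfw w xs) = pfw (\<lambda>x y. f (w x y)) xs"
proof (induction xs rule: length_induct)
  case (1 xs)
  have neg: "f (- x) = - f x" for x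
    using assms(3)[of x "- x"] assms(1) by (simp add: eq_neg_iff_add_eq_0 add.commute)
  have sgn: "f ((- 1) ^ i) = (- 1) ^ i" for i
    by (induction i) (simp_all add: assms neg)
  have fsum: "f (sum g {..<n}) = (\<Sum>i<n. f (g i))" for g and n :: nat
    by (induction n) (simp_all add: assms)
  show ?case
  proof (cases xs)
    case (Cons y ys)
    show ?thesis
      unfolding Cons pfw_Cons fsum
      by (intro sum.cong) (auto simp: Cons 1 length_delete_nth assms sgn)
  qed (simp add: assms)
qed

text \<open>In the expansion along the first row, \<open>x\<close> enters each term once: as the
  first letter, as its partner, or inside the shorter word. Both \<open>w x z\<close> and
  \<open>w z x\<close> are prescribed since no symmetry of \<open>w\<close> is assumed here.\<close>

lemma pfw_linear:
  assumes fin: "finite B"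
  assumes "\<And>z. z \<in> set as \<union> set bs \<Longrightarrow> w x z = (\<Sum>b\<in>B. c b * w (y b) z)"
    and "\<And>z. z \<in> set as \<union> set bs \<Longrightarrow> w z x = (\<Sum>b\<in>B. c b * w z (y b))"
  shows "pfw w (as @ x # bs) = (\<Sum>b\<in>B. c b * pfw w (as @ y b # bs))"
  using assms(2,3)
proof (induction "length as + length bs" arbitrary: as bs rule: less_induct)
  case less
  show ?case
  proof (cases as)
    case Nil
    have "pfw w (x # bs) = (\<Sum>i<length bs. \<Sum>b\<in>B. c b * ((- 1) ^ i * w (y b) (bs ! i) * pfw w (delete_nth i bs)))"
      unfolding pfw_Cons using less(2) Nil
      by (intro sum.cong) (auto simp: sum_distrib_left sum_distrib_right mult_ac)
    also have "\<dots> = (\<Sum>b\<in>B. c b * pfw w (y b # bs))"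
      unfolding pfw_Cons sum_distrib_left by (rule sum.swap)
    finally show ?thesis using Nil by simp
  next
    case (Cons a as')
    have *: "(- 1) ^ i * w a ((as' @ x # bs) ! i) * pfw w (delete_nth i (as' @ x # bs))
       = (\<Sum>b\<in>B. c b * ((- 1) ^ i * w a ((as' @ y b # bs) ! i) * pfw w (delete_nth i (as' @ y b # bs))))"
      if i: "i < length (as' @ x # bs)" for i
    proof -
      consider "i < length as'" | "i = length as'" | "i > length as'" by linarith
      then show ?thesis
      proof cases
        assume i: "i < length as'"
        have "pfw w (delete_nth i as' @ x # bs) = (\<Sum>b\<in>B. c b * pfw w (delete_nth i as' @ y b # bs))"
          using i less(2,3) Cons set_delete_nth[of i as']
          by (intro less(1)) (auto simp: length_delete_nth)
        then show ?thesis using i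
          by (simp add: delete_nth_append nth_append sum_distrib_left mult_ac)
      next
        assume i: "i = length as'"
        then show ?thesis using less(3)[of a] Cons
          by (simp add: delete_nth_append nth_append sum_distrib_left sum_distrib_right mult_ac)
      next
        assume i': "i > length as'"
        define j where "j = i - Suc (length as')"
        have j: "i - length as' = Suc j" "j < length bs" using i i' by (auto simp: j_def)
        have "pfw w (as' @ x # delete_nth j bs) = (\<Sum>b\<in>B. c b * pfw w (as' @ y b # delete_nth j bs))"
          using j less(2,3) Cons set_delete_nth[of j bs]
          by (intro less(1)) (auto simp: length_delete_nth)
        then show ?thesis using i' j
          by (simp add: delete_nth_append nth_append sum_distrib_left mult_ac)
      qed
    qed
    have "pfw w (as @ x # bs) = (\<Sum>i<Suc (length as' + length bs).
        (- 1) ^ i * w a ((as' @ x # bs) ! i) * pfw w (delete_nth i (as' @ x # bs)))"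
      by (simp add: Cons pfw_Cons)
    also have "\<dots> = (\<Sum>i<Suc (length as' + length bs). \<Sum>b\<in>B. c b * ((- 1) ^ i * w a ((as' @ y b # bs) ! i) * pfw w (delete_nth i (as' @ y b # bs))))"
      by (intro sum.cong refl *) auto
    also have "\<dots> = (\<Sum>b\<in>B. c b * pfw w (as @ y b # bs))"
      by (subst sum.swap) (simp add: Cons pfw_Cons sum_distrib_left del: sum.lessThan_Suc)
    finally show ?thesis .
  qed
qed

section \<open>The Pfaffian as an alternating function of its letters\<close>

lemma sum_lessThan_adjacent_swap:
  fixes f g :: "nat \<Rightarrow> 'a::comm_monoid_add"
  assumes "Suc k < n" and "f k = g (Suc k)" and "f (Suc k) = g k"
    and "\<And>i. i < n \<Longrightarrow> i \<noteq> k \<Longrightarrow> i \<noteq> Suc k \<Longrightarrow> f i = g i"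
  shows "sum f {..<n} = sum g {..<n}"
  by (rule sum.reindex_bij_witness[of _ "transpose k (Suc k)" "transpose k (Suc k)"])
     (use assms in \<open>auto simp: Transposition.transpose_def\<close>)

text \<open>Vanishing on the diagonal is a separate axiom because skew symmetry alone yields only
  \<open>2 * w x x = 0\<close>.\<close>

locale alternating_form =
  fixes w :: "'a \<Rightarrow> 'a \<Rightarrow> 'r::comm_ring_1"
  assumes diag: "w x x = 0" and skew: "w x y = - w y x"
begin

text \<open>Two letters at different places can be deleted in either order. Changing the order
  shifts one index by 1, which flips the sign, and exchanges the two arguments of
  \<open>f\<close>.\<close>

lemma sum_delete_two:
  fixes f :: "'a \<Rightarrow> 'a \<Rightarrow> 'a list \<Rightarrow> 'r"
  shows "(\<Sum>i<length bs. \<Sum>j<length bs - 1. (- 1) ^ (i + j) * f (bs ! i) (delete_nth i bs ! j) (delete_nth j (delete_nth i bs)))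
   = - (\<Sum>i<length bs. \<Sum>j<length bs - 1. (- 1) ^ (i + j) * f (delete_nth i bs ! j) (bs ! i) (delete_nth j (delete_nth i bs)))"
proof -
  let ?n = "length bs"
  \<comment> \<open>\<open>(i, j)\<close> means: delete place \<open>i\<close>, then place
    \<open>j\<close> of the shortened word. In the opposite order the same two letters are addressed
    by \<open>(j, i - 1)\<close> if \<open>j < i\<close>, and by \<open>(Suc j, i)\<close>
    otherwise.\<close>
  let ?flip = "\<lambda>(i, j). if j < i then (j, i - 1) else (Suc j, i)"
  have "(\<Sum>(i, j)\<in>{..<?n} \<times> {..<?n - 1}. (- 1) ^ (i + j) * f (bs ! i) (delete_nth i bs ! j) (delete_nth j (delete_nth i bs)))
    = (\<Sum>(i, j)\<in>{..<?n} \<times> {..<?n - 1}. - ((- 1) ^ (i + j) * f (delete_nth i bs ! j) (bs ! i) (delete_nth j (delete_nth i bs))))"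
  proof (rule sum.reindex_bij_witness[of _ ?flip ?flip])
    fix p assume "p \<in> {..<?n} \<times> {..<?n - 1}"
    then obtain i j where p: "p = (i, j)" "i < ?n" "j < ?n - 1" by auto
    show "?flip (?flip p) = p" "?flip p \<in> {..<?n} \<times> {..<?n - 1}" using p by auto
    then show "?flip (?flip p) = p" "?flip p \<in> {..<?n} \<times> {..<?n - 1}" by auto
    show "(case ?flip p of (i, j) \<Rightarrow> - ((- 1) ^ (i + j) * f (delete_nth i bs ! j) (bs ! i) (delete_nth j (delete_nth i bs)))) =
      (case p of (i, j) \<Rightarrow> (- 1) ^ (i + j) * f (bs ! i) (delete_nth i bs ! j) (delete_nth j (delete_nth i bs)))"
    proof (cases "j < i")
      case True
      then obtain i' where i': "i = Suc i'" by (cases i) auto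
      show ?thesis using p True delete_nth_commute[of j i bs] by (auto simp: i' nth_delete_nth add.commute)
    next
      case False
      then show ?thesis using p delete_nth_commute[of i "Suc j" bs] by (auto simp: nth_delete_nth add.commute)
    qed
  qed
  then show ?thesis
    by (simp add: sum.cartesian_product[symmetric] sum_negf)
qed

text \<open>Splits the matchings by the partner of \<open>x\<close>: it is \<open>y\<close>, or the
  partners of \<open>x\<close> and \<open>y\<close> both lie in \<open>bs\<close>. The second part
  becomes a sum over two successive deletions, where the roles of \<open>x\<close> and
  \<open>y\<close> can be compared.\<close>

lemma pfw_Cons_Cons:
  "pfw w (x # y # bs) = w x y * pfw w bs
    - (\<Sum>i<length bs. \<Sum>j<length bs - 1. (- 1) ^ (i + j) * (w x (bs ! i) * w y (delete_nth i bs ! j) * pfw w (delete_nth j (delete_nth i bs))))"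
proof -
  have "pfw w (x # y # bs) = w x y * pfw w bs
     + (\<Sum>i<length bs. (- 1) ^ Suc i * w x (bs ! i) * pfw w (y # delete_nth i bs))"
    by (subst pfw_Cons) (simp add: sum.lessThan_Suc_shift del: sum.lessThan_Suc)
  also have "(\<Sum>i<length bs. (- 1) ^ Suc i * w x (bs ! i) * pfw w (y # delete_nth i bs))
    = - (\<Sum>i<length bs. \<Sum>j<length bs - 1. (- 1) ^ (i + j) * (w x (bs ! i) * w y (delete_nth i bs ! j) * pfw w (delete_nth j (delete_nth i bs))))"
    unfolding sum_negf[symmetric]
    by (intro sum.cong refl) (auto simp: pfw_Cons length_delete_nth sum_distrib_left sum_negf power_add mult_ac)
  finally show ?thesis by simp
qed

text \<open>At the front of the word, the pair term changes sign by skew symmetry and the double sum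
  by \<open>sum_delete_two\<close>. Behind a first letter \<open>c\<close>, the terms that match
  \<open>c\<close> with \<open>x\<close> leave the same rest in both words but stand at neighbouring
  positions, hence with opposite signs; likewise for \<open>y\<close>. Induction covers the other
  terms.\<close>

lemma pfw_swap: "pfw w (as @ x # y # bs) = - pfw w (as @ y # x # bs)"
proof (induction "length as + length bs" arbitrary: as bs rule: less_induct)
  case less
  show ?case
  proof (cases as)
    case Nil
    show ?thesis
      unfolding Nil append_Nil pfw_Cons_Cons
      using sum_delete_two[where bs = bs and f = "\<lambda>a b cs. w x a * w y b * pfw w cs"]
      by (simp add: skew[of x y] mult.commute mult.left_commute)
  next
    case (Cons c as')
    let ?f = "\<lambda>x y i. (- 1) ^ i * w c ((as' @ x # y # bs) ! i) * pfw w (delete_nth i (as' @ x # y # bs))"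
    let ?k = "length as'"
    have "(\<Sum>i<?k + 2 + length bs. ?f x y i) = (\<Sum>i<?k + 2 + length bs. - ?f y x i)"
    proof (rule sum_lessThan_adjacent_swap[of ?k])
      fix i assume i: "i < ?k + 2 + length bs" "i \<noteq> ?k" "i \<noteq> Suc ?k"
      show "?f x y i = - ?f y x i"
      proof (cases "i < ?k")
        case True
        then show ?thesis
          using less[of "delete_nth i as'" bs] Cons
          by (simp add: delete_nth_append nth_append length_delete_nth)
      next
        case False
        define j where "j = i - ?k - 2"
        have j: "i - ?k = Suc (Suc j)" "j < length bs" using False i by (auto simp: j_def)
        show ?thesis
          using less[of as' "delete_nth j bs"] Cons j False
          by (simp add: delete_nth_append nth_append length_delete_nth)
      qed
    qed (auto simp: delete_nth_append nth_append)
    then show ?thesis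
      by (simp add: Cons pfw_Cons sum_negf add.commute add.left_commute)
  qed
qed

text \<open>\<open>pfw_swap\<close> for equal letters would only show that twice the value is 0.
  Instead, each deletion of two places from \<open>bs\<close> is cancelled against the deletion of
  the same places in the other order.\<close>

lemma pfw_repeat: "pfw w (as @ x # x # bs) = 0"
proof (induction "length as + length bs" arbitrary: as bs rule: less_induct)
  case less
  show ?case
  proof (cases as)
    case Nil
    let ?n = "length bs"
    let ?F = "\<lambda>i j. (- 1) ^ (i + j) * (w x (bs ! i) * w x (delete_nth i bs ! j) * pfw w (delete_nth j (delete_nth i bs)))"
    let ?flip = "\<lambda>(i, j). if j < i then (j, i - 1) else (Suc j, i)"
    let ?lo = "{p \<in> {..<?n} \<times> {..<?n - 1}. snd p < fst p}"
    let ?hi = "{p \<in> {..<?n} \<times> {..<?n - 1}. \<not> snd p < fst p}"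
    have "(\<Sum>p\<in>?lo. case p of (i, j) \<Rightarrow> ?F i j) = (\<Sum>p\<in>?hi. - (case p of (i, j) \<Rightarrow> ?F i j))"
    proof (rule sum.reindex_bij_witness[of _ ?flip ?flip])
      fix p assume "p \<in> ?lo"
      then obtain i j where p: "p = (Suc i, j)" "Suc i < ?n" "j < Suc i"
        by (cases p; cases "fst p") auto
      show "?flip (?flip p) = p" "?flip p \<in> ?hi" using p by auto
      show "- (case ?flip p of (i, j) \<Rightarrow> ?F i j) = (case p of (i, j) \<Rightarrow> ?F i j)"
        using p delete_nth_commute[of j "Suc i" bs] by (auto simp: nth_delete_nth add.commute mult_ac)
    qed auto
    moreover have "(\<Sum>i<?n. \<Sum>j<?n - 1. ?F i j) = (\<Sum>p\<in>{..<?n} \<times> {..<?n - 1}. case p of (i, j) \<Rightarrow> ?F i j)"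
      by (simp add: sum.cartesian_product)
    moreover have "\<dots> = (\<Sum>p\<in>?lo. case p of (i, j) \<Rightarrow> ?F i j) + (\<Sum>p\<in>?hi. case p of (i, j) \<Rightarrow> ?F i j)"
      by (subst sum.union_disjoint[symmetric]) (auto intro!: sum.cong)
    ultimately have "(\<Sum>i<?n. \<Sum>j<?n - 1. ?F i j) = 0"
      by (simp add: sum_negf)
    then show ?thesis
      unfolding Nil append_Nil pfw_Cons_Cons by (simp add: diag)
  next
    case (Cons c as')
    let ?f = "\<lambda>i. (- 1) ^ i * w c ((as' @ x # x # bs) ! i) * pfw w (delete_nth i (as' @ x # x # bs))"
    let ?k = "length as'"
    have "?f i = 0" if i: "i < ?k + 2 + length bs" "i \<noteq> ?k" "i \<noteq> Suc ?k" for i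
    proof (cases "i < ?k")
      case True
      then show ?thesis
        using less[of "delete_nth i as'" bs] Cons
        by (simp add: delete_nth_append nth_append length_delete_nth)
    next
      case False
      define j where "j = i - ?k - 2"
      have j: "i - ?k = Suc (Suc j)" "j < length bs" using False i by (auto simp: j_def)
      show ?thesis
        using less[of as' "delete_nth j bs"] Cons j False
        by (simp add: delete_nth_append nth_append length_delete_nth)
    qed
    then have "(\<Sum>i<?k + 2 + length bs. ?f i) = (\<Sum>i\<in>{?k, Suc ?k}. ?f i)"
      by (intro sum.mono_neutral_right) auto
    also have "\<dots> = 0" by (simp add: delete_nth_append nth_append)
    finally show ?thesis
      by (simp add: Cons pfw_Cons add.commute add.left_commute)
  qed
qed

end

section \<open>Pfaffians as sums over perfect matchings\<close>

text \<open>The increasing enumeration of the naturals other than \<open>0\<close> and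
  \<open>i + 1\<close>; it relabels the points left over when this pair is removed.\<close>

definition skip :: "nat \<Rightarrow> nat \<Rightarrow> nat" where
  "skip i k = (if k < i then Suc k else Suc (Suc k))"

text \<open>Puts the pair \<open>{0, i + 1}\<close> in front of a perfect matching of the other points.\<close>

definition match_ext :: "nat \<Rightarrow> (nat \<Rightarrow> nat) \<Rightarrow> nat \<Rightarrow> nat" where
  "match_ext i p k = (case k of 0 \<Rightarrow> 0 | Suc 0 \<Rightarrow> Suc i | Suc (Suc k) \<Rightarrow> skip i (p k))"

lemma match_ext_simps [simp]:
  "match_ext i p 0 = 0" "match_ext i p (Suc 0) = Suc i" "match_ext i p (Suc (Suc k)) = skip i (p k)"
  "match_ext i p 2 = skip i (p 0)"
  by (simp_all add: match_ext_def numeral_2_eq_2)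

lemma skip_less_iff [simp]: "skip i a < skip i b \<longleftrightarrow> a < b"
  by (auto simp: skip_def)

lemma nat_cases2: "(k = 0 \<Longrightarrow> P) \<Longrightarrow> (k = Suc 0 \<Longrightarrow> P) \<Longrightarrow> (\<And>l. k = Suc (Suc l) \<Longrightarrow> P) \<Longrightarrow> P"
  by (metis not0_implies_Suc)

text \<open>Separates putting the pair \<open>{0, 1}\<close> in front from moving its second point
  to \<open>i + 1\<close>, so that the two contributions to the sign can be computed one by
  one.\<close>

lemma match_ext_comp: "match_ext i p = match_ext i id \<circ> match_ext 0 p"
proof
  fix k show "match_ext i p k = (match_ext i id \<circ> match_ext 0 p) k"
    by (rule nat_cases2[of k]) (auto simp: skip_def)
qed

text \<open>Shifting all points by 2 turns a transposition into a transposition, and the induction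
  builds \<open>p\<close> from transpositions.\<close>

lemma match_ext_0:
  assumes "p permutes {..<n}"
  shows "match_ext 0 p permutes {..<n + 2} \<and> sign (match_ext 0 p) = sign p"
  using assms finite_lessThan
proof (induction p rule: permutes_induct)
  case id
  have "match_ext 0 id = id"
  proof
    fix k show "match_ext 0 id k = id k"
      by (rule nat_cases2[of k]) (auto simp: skip_def)
  qed
  then show ?case using permutes_id by (simp only: simp_thms)
next
  case (swap a b p)
  have eq: "match_ext 0 (transpose a b \<circ> p) = transpose (a + 2) (b + 2) \<circ> match_ext 0 p"
  proof
    fix k show "match_ext 0 (transpose a b \<circ> p) k = (transpose (a + 2) (b + 2) \<circ> match_ext 0 p) k"
      by (rule nat_cases2[of k]) (auto simp: skip_def Transposition.transpose_def)
  qed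
  have "match_ext 0 p permutes {..<n + 2}" "sign (match_ext 0 p) = sign p" using swap by auto
  moreover have "transpose (a + 2) (b + 2) permutes {..<n + 2}"
    using swap by (intro permutes_swap_id) auto
  ultimately have "transpose (a + 2) (b + 2) \<circ> match_ext 0 p permutes {..<n + 2}"
    and "permutation p" "permutation (match_ext 0 p)"
    using permutes_compose swap.hyps permutation_permutes by blast+
  moreover from this have "sign (transpose (a + 2) (b + 2) \<circ> match_ext 0 p) = sign (transpose a b \<circ> p)"
    using swap
    by (subst (1 2) sign_compose) (auto simp: sign_swap_id permutation_swap_id)
  ultimately show ?case unfolding eq by blast
qed

text \<open>\<open>match_ext i id\<close> is the cycle that sends 1 to \<open>i + 1\<close> and
  lowers 2, ..., \<open>i + 1\<close> by one; each increment of \<open>i\<close> composes it with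
  one transposition of neighbours.\<close>

lemma match_ext_id:
  "i \<le> n \<Longrightarrow> match_ext i id permutes {..<n + 2} \<and> sign (match_ext i id) = (- 1) ^ i"
proof (induction i)
  case 0
  show ?case using match_ext_0[OF permutes_id, of n] unfolding sign_id power_0 .
next
  case (Suc i)
  have eq: "match_ext (Suc i) id = transpose (Suc i) (Suc (Suc i)) \<circ> match_ext i id"
  proof
    fix k show "match_ext (Suc i) id k = (transpose (Suc i) (Suc (Suc i)) \<circ> match_ext i id) k"
      by (rule nat_cases2[of k]) (auto simp: skip_def Transposition.transpose_def)
  qed
  have *: "match_ext i id permutes {..<n + 2}" "sign (match_ext i id) = (- 1) ^ i" using Suc.IH[OF Suc_leD[OF Suc.prems]] by blast+
  moreover have t: "transpose (Suc i) (Suc (Suc i)) permutes {..<n + 2}"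
    using Suc by (intro permutes_swap_id) auto
  ultimately have "permutation (match_ext i id)"
    using permutation_permutes by blast
  then have "sign (transpose (Suc i) (Suc (Suc i)) \<circ> match_ext i id) = (- 1) ^ Suc i"
    by (subst sign_compose) (simp_all add: * sign_swap_id permutation_swap_id)
  then show ?case
    using permutes_compose[OF *(1) t] unfolding eq by blast
qed

lemma match_ext:
  assumes "p permutes {..<n}" and "i \<le> n"
  shows "match_ext i p permutes {..<n + 2}" and "sign (match_ext i p) = (- 1) ^ i * sign p"
proof -
  note a = match_ext_0[OF assms(1)] and b = match_ext_id[OF assms(2)]
  show "match_ext i p permutes {..<n + 2}"
    using a b by (subst match_ext_comp) (auto intro: permutes_compose)
  have "permutation (match_ext i id)" "permutation (match_ext 0 p)"
    using a b by (auto simp: permutation_permutes)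
  then show "sign (match_ext i p) = (- 1) ^ i * sign p"
    using a b by (subst match_ext_comp) (auto simp: sign_compose)
qed

text \<open>The first elements of the pairs increase and each is the smaller one of its pair, so the
  least point can only stand in front.\<close>

lemma matching_perms_fix_0:
  assumes "p \<in> matching_perms (Suc n)"
  shows "p 0 = 0"
proof -
  have p: "p permutes {..<2 * Suc n}" and lt: "\<And>i. i < Suc n \<Longrightarrow> p (2 * i) < p (2 * i + 1)"
    and mono: "\<And>i. i + 1 < Suc n \<Longrightarrow> p (2 * i) < p (2 * (i + 1))"
    using assms unfolding matching_perms_def by auto
  have ge: "p 0 \<le> p (2 * i)" if "i < Suc n" for i
    using that
  proof (induction i)
    case (Suc i)
    then show ?case using mono[of i] by simp
  qed simp
  obtain k where k: "p k = 0" "k < 2 * Suc n"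
    using permutes_image[OF p] by (metis imageE lessThan_iff zero_less_Suc nat_0_less_mult_iff pos2)
  show ?thesis
  proof (cases "even k")
    case True
    then obtain i where "k = 2 * i" by auto
    then show ?thesis using k ge[of i] by auto
  next
    case False
    then obtain i where "k = 2 * i + 1" by (auto elim: oddE)
    then show ?thesis using k lt[of i] by auto
  qed
qed

lemma match_ext_in_matching_perms:
  assumes "p \<in> matching_perms n" "i < Suc (2 * n)"
  shows "match_ext i p \<in> matching_perms (Suc n)"
proof -
  have p: "p permutes {..<2 * n}" and lt: "\<And>i. i < n \<Longrightarrow> p (2 * i) < p (2 * i + 1)"
    and mono: "\<And>i. i + 1 < n \<Longrightarrow> p (2 * i) < p (2 * (i + 1))"
    using assms unfolding matching_perms_def by auto
  have "match_ext i p (2 * k) < match_ext i p (2 * k + 1)" if "k < Suc n" for k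
    using that lt[of "k - 1"] by (cases k) auto
  moreover have "match_ext i p (2 * k) < match_ext i p (2 * (k + 1))" if "k + 1 < Suc n" for k
    using that mono[of "k - 1"] by (cases k) (auto, simp add: skip_def)
  ultimately show ?thesis
    using match_ext(1)[OF p, of i] assms(2) by (simp add: matching_perms_def)
qed

text \<open>The matching without its first pair; subtracting 1 or 2 undoes the relabelling by
  \<open>skip\<close>.\<close>

definition match_red :: "(nat \<Rightarrow> nat) \<Rightarrow> nat \<Rightarrow> nat" where
  "match_red p k = (if p (Suc (Suc k)) < p (Suc 0) then p (Suc (Suc k)) - 1 else p (Suc (Suc k)) - 2)"

lemma match_red:
  assumes "p \<in> matching_perms (Suc n)"
  shows "match_red p \<in> matching_perms n" and "match_ext (p (Suc 0) - 1) (match_red p) = p"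
    and "p (Suc 0) - 1 < Suc (2 * n)"
proof -
  have p: "p permutes {..<2 * n + 2}" and lt: "\<And>i. i < Suc n \<Longrightarrow> p (2 * i) < p (2 * i + 1)"
    and mono: "\<And>i. i + 1 < Suc n \<Longrightarrow> p (2 * i) < p (2 * (i + 1))"
    using assms unfolding matching_perms_def by auto
  have p0: "p 0 = 0" using matching_perms_fix_0[OF assms] .
  have inj: "p x = p y \<longleftrightarrow> x = y" for x y
    using permutes_inj[OF p] by (auto simp: inj_def)
  have p1: "p (Suc 0) > 0" "p (Suc 0) < 2 * n + 2"
    using inj[of "Suc 0" 0] p0 permutes_in_image[OF p, of "Suc 0"] by auto
  then show "p (Suc 0) - 1 < Suc (2 * n)" by simp
  have pos: "p (Suc (Suc k)) \<noteq> 0" "p (Suc (Suc k)) \<noteq> p (Suc 0)" for k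
    using inj[of "Suc (Suc k)" 0] p0 inj by auto
  have skip: "skip (p (Suc 0) - 1) (match_red p k) = p (Suc (Suc k))" for k
    using pos[of k] p1 by (auto simp: skip_def match_red_def)
  show ext: "match_ext (p (Suc 0) - 1) (match_red p) = p"
  proof
    fix k show "match_ext (p (Suc 0) - 1) (match_red p) k = p k"
      by (rule nat_cases2[of k]) (use p0 p1 skip in auto)
  qed
  have less: "match_red p a < match_red p b \<longleftrightarrow> p (Suc (Suc a)) < p (Suc (Suc b))" for a b
    by (metis skip skip_less_iff)
  have "match_red p permutes {..<2 * n}"
  proof (rule bij_imp_permutes)
    have "match_red p ` {..<2 * n} \<subseteq> {..<2 * n}"
    proof safe
      fix k assume "k < 2 * n"
      then have "p (Suc (Suc k)) < 2 * n + 2" using permutes_in_image[OF p, of "Suc (Suc k)"] by auto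
      then show "match_red p k < 2 * n" using p1 pos[of k] by (auto simp: match_red_def)
    qed
    moreover have "inj_on (match_red p) {..<2 * n}"
      by (rule inj_onI) (metis skip inj nat.inject)
    ultimately show "bij_betw (match_red p) {..<2 * n} {..<2 * n}"
      using endo_inj_surj[of "{..<2 * n}" "match_red p"] by (simp add: bij_betw_def)
    fix k assume "k \<notin> {..<2 * n}"
    then have "p (Suc (Suc k)) = Suc (Suc k)" using permutes_not_in[OF p, of "Suc (Suc k)"] by auto
    then show "match_red p k = k" using p1 \<open>k \<notin> _\<close> by (auto simp: match_red_def)
  qed
  then show "match_red p \<in> matching_perms n"
    using lt[of "Suc _"] mono[of "Suc _"] by (auto simp: matching_perms_def less)
qed

text \<open>A perfect matching of \<open>2 * n + 2\<close> points amounts to the partner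
  \<open>i + 1\<close> of 0 and a perfect matching of the other points. The factor
  \<open>(- 1) ^ i\<close> in the sign of \<open>match_ext\<close> is the sign of the expansion
  along the first row.\<close>

lemma sum_matching_perms_eq_pfw:
  "(\<Sum>p\<in>matching_perms n. of_int (sign p) * (\<Prod>i<n. w (p (2 * i)) (p (2 * i + 1))))
     = pfw w [0..<2 * n]"
proof (induction n arbitrary: w)
  case 0
  have "matching_perms 0 = {id}" by (auto simp: matching_perms_def permutes_empty)
  then show ?case by simp
next
  case (Suc n)
  have del: "delete_nth i [Suc 0..<Suc (Suc (2 * n))] = map (skip i) [0..<2 * n]" if "i < Suc (2 * n)" for i
    by (rule nth_equalityI) (use that in \<open>auto simp: length_delete_nth nth_delete_nth skip_def simp del: upt_Suc\<close>)
  have "pfw w [0..<2 * Suc n] = pfw w (0 # [1..<2 * Suc n])"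
    by (simp add: upt_rec)
  also have "\<dots> = (\<Sum>i<Suc (2 * n). (- 1) ^ i * w 0 (Suc i) * pfw (\<lambda>a b. w (skip i a) (skip i b)) [0..<2 * n])"
    unfolding pfw_Cons by (intro sum.cong) (auto simp: del pfw_map simp del: upt_Suc)
  also have "\<dots> = (\<Sum>i<Suc (2 * n). \<Sum>p\<in>matching_perms n. (- 1) ^ i * w 0 (Suc i) *
      (of_int (sign p) * (\<Prod>k<n. w (skip i (p (2 * k))) (skip i (p (2 * k + 1))))))"
    unfolding Suc[symmetric] sum_distrib_left ..
  also have "\<dots> = (\<Sum>(i, p)\<in>{..<Suc (2 * n)} \<times> matching_perms n. (- 1) ^ i * w 0 (Suc i) *
      (of_int (sign p) * (\<Prod>k<n. w (skip i (p (2 * k))) (skip i (p (2 * k + 1))))))"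
    by (rule sum.cartesian_product)
  also have "\<dots> = (\<Sum>p\<in>matching_perms (Suc n). of_int (sign p) * (\<Prod>i<Suc n. w (p (2 * i)) (p (2 * i + 1))))"
  proof (rule sum.reindex_bij_witness[of _ "\<lambda>p. (p (Suc 0) - 1, match_red p)" "\<lambda>(i, p). match_ext i p"])
    fix ip assume "ip \<in> {..<Suc (2 * n)} \<times> matching_perms n"
    then obtain i p where ip: "ip = (i, p)" "i < Suc (2 * n)" "p \<in> matching_perms n" by auto
    then have p: "p permutes {..<2 * n}" by (simp add: matching_perms_def)
    show "(\<lambda>p. (p (Suc 0) - 1, match_red p)) (case ip of (i, p) \<Rightarrow> match_ext i p) = ip"
      by (auto simp: ip match_red_def fun_eq_iff skip_def)
    show "(case ip of (i, p) \<Rightarrow> match_ext i p) \<in> matching_perms (Suc n)"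
      using ip by (auto intro: match_ext_in_matching_perms)
    have "(\<Prod>k<Suc n. w (match_ext i p (2 * k)) (match_ext i p (2 * k + 1)))
      = w 0 (Suc i) * (\<Prod>k<n. w (skip i (p (2 * k))) (skip i (p (2 * k + 1))))"
      by (simp add: prod.lessThan_Suc_shift del: prod.lessThan_Suc)
    then show "(\<lambda>p. of_int (sign p) * (\<Prod>i<Suc n. w (p (2 * i)) (p (2 * i + 1)))) (case ip of (i, p) \<Rightarrow> match_ext i p) =
      (case ip of (i, p) \<Rightarrow> (- 1) ^ i * w 0 (Suc i) *
      (of_int (sign p) * (\<Prod>k<n. w (skip i (p (2 * k))) (skip i (p (2 * k + 1))))))"
      using ip match_ext(2)[OF p, of i] by (simp add: mult_ac)
  qed (use match_red in \<open>auto simp del: One_nat_def\<close>)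
  finally show ?case ..
qed

lemma pf_eq_pfw:
  assumes "even (dim_row M)"
  shows "pf M = pfw (\<lambda>i j. M $$ (i, j)) [0..<dim_row M]"
proof -
  have "dim_row M = 2 * (dim_row M div 2)" using assms by simp
  then show ?thesis
    using sum_matching_perms_eq_pfw[where n = "dim_row M div 2" and w = "\<lambda>i j. M $$ (i, j)"]
    by (simp add: pf_def Let_def)
qed

text \<open>\<open>pick\<close> and \<open>filter\<close> both list the chosen row numbers
  increasingly, and strictly sorted lists with the same elements agree.\<close>

lemma pf_submatrix:
  assumes M: "M \<in> carrier_mat N N" and ev: "even (card {i. i < N \<and> i \<in> K})"
  shows "pf (submatrix M K K) = pfw (\<lambda>i j. M $$ (i, j)) (filter (\<lambda>i. i \<in> K) [0..<N])"
proof -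
  let ?K = "{i. i < N \<and> i \<in> K}"
  have eq: "map (pick K) [0..<card ?K] = filter (\<lambda>i. i \<in> K) [0..<N]"
  proof (rule strict_sorted_equal)
    have mono: "pick K i < pick K j" if "i < j" "j < card ?K" for i j
      using that pick_reduce_set[of i N K] pick_reduce_set[of j N K] pick_mono_le[of j ?K i] by simp
    show "sorted_wrt (<) (map (pick K) [0..<card ?K])"
      by (auto simp: sorted_wrt_iff_nth_less mono)
    show "sorted_wrt (<) (filter (\<lambda>i. i \<in> K) [0..<N])"
      by (simp add: sorted_wrt_filter)
    have "pick K ` {0..<card ?K} = ?K"
    proof (rule card_subset_eq)
      show "pick K ` {0..<card ?K} \<subseteq> ?K"
        using pick_in_set_le[where S = ?K] pick_reduce_set[of _ N K] by fastforce
      have "inj_on (pick K) {0..<card ?K}"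
        by (rule linorder_inj_onI') (use mono in force)
      then show "card (pick K ` {0..<card ?K}) = card ?K"
        by (simp add: card_image)
    qed auto
    then show "set (map (pick K) [0..<card ?K]) = set (filter (\<lambda>i. i \<in> K) [0..<N])"
      by auto
  qed
  have dim: "dim_row (submatrix M K K) = card ?K" using M by (simp add: dim_submatrix)
  have "pf (submatrix M K K) = pfw (\<lambda>i j. M $$ (pick K i, pick K j)) [0..<card ?K]"
    using M ev by (subst pf_eq_pfw) (auto simp: dim submatrix_index intro!: pfw_cong)
  then show ?thesis by (simp add: pfw_map flip: eq)
qed

section \<open>Alternating functions on words\<close>

lemma finite_words: "finite (set L) \<Longrightarrow> finite {g. length g = m \<and> set g \<subseteq> set L}"
  using finite_lists_length_eq[of "set L" m] by (simp add: conj_commute)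

text \<open>Isolates the two properties on which rearrangement rests, so that the results also apply
  to words whose tail is held fixed, as in \<open>alternating_words_append\<close>.\<close>

locale alternating_words =
  fixes f :: "'a list \<Rightarrow> 'r::comm_ring_1"
  assumes swap: "f (as @ x # y # bs) = - f (as @ y # x # bs)"
    and repeat: "f (as @ x # x # bs) = 0"
begin

lemma move_right: "f (as @ x # bs @ cs) = (- 1) ^ length bs * f (as @ bs @ x # cs)"
proof (induction bs arbitrary: as)
  case (Cons b bs)
  show ?case using swap[of as x b "bs @ cs"] Cons[of "as @ [b]"] by simp
qed simp

lemma move_block: "f (as @ xs @ bs @ cs) = (- 1) ^ (length xs * length bs) * f (as @ bs @ xs @ cs)"
proof (induction xs arbitrary: as)
  case (Cons x xs)
  show ?case using Cons[of "as @ [x]"] move_right[of as x bs "xs @ cs"]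
    by (simp add: power_add mult_ac)
qed simp

lemma move_even_block: "even (length xs) \<Longrightarrow> f (as @ xs @ bs @ cs) = f (as @ bs @ xs @ cs)"
  using move_block[of as xs bs cs] by simp

lemma repeat_apart: "f (as @ x # bs @ x # cs) = 0"
  using move_right[of as x bs "x # cs"] repeat[of "as @ bs" x cs] by simp

lemma not_distinct:
  assumes "\<not> distinct g" shows "f g = 0"
proof -
  obtain xs ys zs x where "g = xs @ [x] @ ys @ [x] @ zs"
    using assms not_distinct_decomp by blast
  then show ?thesis using repeat_apart[of xs x ys zs] by simp
qed

lemma swap_apart: "f (as @ x # bs @ y # cs) = - f (as @ y # bs @ x # cs)"
proof -
  have "f (as @ x # bs @ y # cs) = (- 1) ^ length bs * f (as @ bs @ x # y # cs)"
    by (rule move_right)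
  also have "f (as @ bs @ x # y # cs) = - f (as @ bs @ y # x # cs)"
    using swap[of "as @ bs" x y cs] by simp
  also have "(- 1) ^ length bs * - f (as @ bs @ y # x # cs) = - f (as @ y # bs @ x # cs)"
    by (simp add: move_right[of as y bs])
  finally show ?thesis .
qed

lemma permute_list_transpose:
  assumes "a < b" "b < length g"
  shows "f (permute_list (transpose a b) g) = - f g"
proof -
  define xs ys zs where "xs = take a g" and "ys = take (b - Suc a) (drop (Suc a) g)" and "zs = drop (Suc b) g"
  define ga gb where "ga = g ! a" and "gb = g ! b"
  have g: "g = xs @ ga # ys @ gb # zs"
  proof -
    have "g = take a g @ g ! a # drop (Suc a) g"
      using assms by (intro id_take_nth_drop) simp
    also have "drop (Suc a) g = take (b - Suc a) (drop (Suc a) g) @ drop (Suc a) g ! (b - Suc a) #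
        drop (Suc (b - Suc a)) (drop (Suc a) g)"
      using assms by (intro id_take_nth_drop) simp
    also have "take a g @ g ! a # \<dots> = xs @ ga # ys @ gb # zs"
      using assms by (simp add: xs_def ys_def zs_def ga_def gb_def)
    finally show ?thesis .
  qed
  have len: "length xs = a" "length ys = b - Suc a" using assms by (auto simp: xs_def ys_def)
  have "permute_list (transpose a b) g = xs @ gb # ys @ ga # zs"
  proof (rule nth_equalityI)
    show "length (permute_list (transpose a b) g) = length (xs @ gb # ys @ ga # zs)"
      unfolding g by simp
    fix i assume "i < length (permute_list (transpose a b) g)"
    then have i: "i < length g" by simp
    have "permute_list (transpose a b) g ! i = g ! transpose a b i"
      using i by (simp add: permute_list_def)
    also have "\<dots> = (xs @ gb # ys @ ga # zs) ! i"
    proof (cases "i = a \<or> i = b")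
      case True
      then show ?thesis using assms len
        by (auto simp: nth_append nth_Cons' ga_def gb_def)
    next
      case False
      then have "g ! transpose a b i = (xs @ ga # ys @ gb # zs) ! i"
        unfolding g[symmetric] by simp
      then show ?thesis using False len assms by (auto simp: nth_append nth_Cons' split: if_splits)
    qed
    finally show "permute_list (transpose a b) g ! i = (xs @ gb # ys @ ga # zs) ! i" .
  qed
  then have "f (permute_list (transpose a b) g) = f (xs @ gb # ys @ ga # zs)"
    by (rule arg_cong)
  also have "\<dots> = - f (xs @ ga # ys @ gb # zs)"
    by (rule swap_apart)
  also have "xs @ ga # ys @ gb # zs = g"
    by (rule g[symmetric])
  finally show ?thesis .
qed

lemma permute_list_sign:
  assumes "p permutes {..<length g}"
  shows "f (permute_list p g) = of_int (sign p) * f g"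
proof -
  \<comment> \<open>The claim stays general in \<open>g\<close> because the induction step applies
    the hypothesis to a list that has already been transposed.\<close>
  have "\<forall>g. length g = n \<longrightarrow> f (permute_list p g) = of_int (sign p) * f g" if "p permutes {..<n}" for n
    using that finite_lessThan
  proof (induction p rule: permutes_induct)
    case id
    then show ?case by simp
  next
    case (swap a b p)
    have t: "transpose a b permutes {..<n}" using swap.hyps by (intro permutes_swap_id) auto
    have "permutation p" using swap.hyps permutation_permutes by blast
    then have sgn: "sign (transpose a b \<circ> p) = - sign p"
      using swap.hyps by (subst sign_compose) (simp_all add: sign_swap_id permutation_swap_id)
    show ?case
    proof (intro allI impI)
      fix g :: "'a list" assume g: "length g = n"
      have "f (permute_list (transpose a b \<circ> p) g) = of_int (sign p) * f (permute_list (transpose a b) g)"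
        using swap g t by (subst permute_list_compose) auto
      also have "f (permute_list (transpose a b) g) = - f g"
        using permute_list_transpose[of a b g] permute_list_transpose[of b a g] swap.hyps g
        by (cases "a < b") (auto simp: transpose_commute)
      finally show "f (permute_list (transpose a b \<circ> p) g) = of_int (sign (transpose a b \<circ> p)) * f g"
        by (metis sgn of_int_minus mult_minus_left mult_minus_right)
    qed
  qed
  then show ?thesis using assms by blast
qed

text \<open>Since \<open>w\<close> has no repetition, each \<open>g\<close> is
  \<open>permute_list p w\<close> for exactly one \<open>p\<close>. Putting its letters back in
  order costs \<open>sign p\<close>, and the sum over \<open>p\<close> is the Leibniz
  formula.\<close>

lemma sum_rearrangements:
  assumes w: "distinct w" and m: "length w = m"
  shows "(\<Sum>g\<in>{g. length g = m \<and> set g = set w}. (\<Prod>i<m. t i (g ! i)) * f g) =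
    f w * det (mat m m (\<lambda>(i, j). t i (w ! j)))"
proof -
  have "(\<Sum>g\<in>{g. length g = m \<and> set g = set w}. (\<Prod>i<m. t i (g ! i)) * f g)
    = (\<Sum>p\<in>{p. p permutes {..<m}}. (\<Prod>i<m. t i (w ! p i)) * (of_int (sign p) * f w))"
  proof (rule sum.reindex_bij_betw[THEN sym, THEN trans])
    show "bij_betw (\<lambda>p. permute_list p w) {p. p permutes {..<m}} {g. length g = m \<and> set g = set w}"
      unfolding bij_betw_def
    proof
      show "inj_on (\<lambda>p. permute_list p w) {p. p permutes {..<m}}"
      proof (rule inj_onI, safe)
        fix p q assume pq: "p permutes {..<m}" "q permutes {..<m}" "permute_list p w = permute_list q w"
        show "p = q"
        proof
          fix i show "p i = q i"
          proof (cases "i < m")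
            case True
            then have "w ! p i = w ! q i"
              using pq m by (metis permute_list_nth)
            then show ?thesis
              using w pq True m permutes_in_image[of _ "{..<m}" i] by (auto simp: nth_eq_iff_index_eq)
          next
            case False
            then have "p i = i" "q i = i" using pq permutes_not_in by (metis lessThan_iff)+
            then show ?thesis by simp
          qed
        qed
      qed
      show "(\<lambda>p. permute_list p w) ` {p. p permutes {..<m}} = {g. length g = m \<and> set g = set w}"
      proof safe
        fix g assume g: "m = length g" "set g = set w"
        then have "distinct g" using w m by (metis card_distinct distinct_card)
        then have "mset w = mset g" using w g(2) by (simp add: set_eq_iff_mset_eq_distinct)
        then obtain p where "p permutes {..<length w}" "permute_list p w = g"
          using mset_eq_permutation[of g w] by metis
        then show "g \<in> (\<lambda>p. permute_list p w) ` {p. p permutes {..<length g}}" using m g by auto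
      qed (use m in auto)
    qed
    show "(\<Sum>p\<in>{p. p permutes {..<m}}. (\<Prod>i<m. t i (permute_list p w ! i)) * f (permute_list p w)) =
      (\<Sum>p\<in>{p. p permutes {..<m}}. (\<Prod>i<m. t i (w ! p i)) * (of_int (sign p) * f w))"
      using m by (intro sum.cong) (auto simp: permute_list_sign permute_list_nth intro!: prod.cong)
  qed
  also have "\<dots> = f w * (\<Sum>p\<in>{p. p permutes {..<m}}. of_int (sign p) * (\<Prod>i<m. t i (w ! p i)))"
    by (simp add: sum_distrib_left mult_ac)
  also have "(\<Sum>p\<in>{p. p permutes {..<m}}. of_int (sign p) * (\<Prod>i<m. t i (w ! p i)))
    = det (mat m m (\<lambda>(i, j). t i (w ! j)))"
    using permutes_in_image[of _ "{..<m}"]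
    by (subst det_def') (auto simp: atLeast0LessThan intro!: sum.cong prod.cong)
  finally show ?thesis .
qed

text \<open>Words with a repeated letter contribute 0. The others are grouped by their set
  \<open>K\<close> of letters, and each group consists of the rearrangements of one word, the
  letters of \<open>K\<close> in the order of \<open>L\<close>.\<close>

lemma Cauchy_Binet:
  assumes L: "distinct L"
  shows "(\<Sum>g\<in>{g. length g = m \<and> set g \<subseteq> set L}. (\<Prod>i<m. t i (g ! i)) * f g) =
    (\<Sum>K\<in>{K. K \<subseteq> set L \<and> card K = m}.
       f (filter (\<lambda>b. b \<in> K) L) * det (mat m m (\<lambda>(i, j). t i (filter (\<lambda>b. b \<in> K) L ! j))))"
proof -
  let ?W = "{g. length g = m \<and> set g \<subseteq> set L}"
  have fin: "finite ?W" by (simp add: finite_words)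
  have "(\<Sum>g\<in>?W. (\<Prod>i<m. t i (g ! i)) * f g) = (\<Sum>g\<in>{g \<in> ?W. distinct g}. (\<Prod>i<m. t i (g ! i)) * f g)"
    using fin by (intro sum.mono_neutral_right) (auto simp: not_distinct)
  also have "\<dots> = (\<Sum>K\<in>{K. K \<subseteq> set L \<and> card K = m}. \<Sum>g\<in>{g. g \<in> {g \<in> ?W. distinct g} \<and> set g = K}. (\<Prod>i<m. t i (g ! i)) * f g)"
  proof (rule sum.group[symmetric])
    show "finite {g \<in> ?W. distinct g}" by (rule finite_subset[OF _ fin]) auto
    show "finite {K. K \<subseteq> set L \<and> card K = m}" by (rule finite_subset[of _ "Pow (set L)"]) auto
  qed (auto simp: distinct_card)
  also have "\<dots> = (\<Sum>K\<in>{K. K \<subseteq> set L \<and> card K = m}. 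
      f (filter (\<lambda>b. b \<in> K) L) * det (mat m m (\<lambda>(i, j). t i (filter (\<lambda>b. b \<in> K) L ! j))))"
  proof (rule sum.cong[OF refl])
    fix K assume "K \<in> {K. K \<subseteq> set L \<and> card K = m}"
    then have K: "K \<subseteq> set L" "card K = m" by auto
    let ?w = "filter (\<lambda>b. b \<in> K) L"
    have w: "distinct ?w" "set ?w = K" using K L by auto
    then have "length ?w = m" using K distinct_card by metis
    moreover have "{g. g \<in> {g \<in> ?W. distinct g} \<and> set g = K} = {g. length g = m \<and> set g = set ?w}"
      using K w by (auto simp: card_distinct)
    ultimately show "(\<Sum>g\<in>{g. g \<in> {g \<in> ?W. distinct g} \<and> set g = K}. (\<Prod>i<m. t i (g ! i)) * f g) =
      f ?w * det (mat m m (\<lambda>(i, j). t i (?w ! j)))"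
      using sum_rearrangements[of ?w m t] w by simp
  qed
  finally show ?thesis .
qed

end

section \<open>Orthogonal words, dual letters and row operations\<close>

context alternating_form
begin

sublocale alternating_words "pfw w"
  by unfold_locales (rule pfw_swap pfw_repeat)+

lemma alternating_words_append: "alternating_words (\<lambda>g. pfw w (g @ zs))"
proof
  show "pfw w ((as @ x # y # bs) @ zs) = - pfw w ((as @ y # x # bs) @ zs)" for as x y bs
    using swap[of as x y "bs @ zs"] by simp
  show "pfw w ((as @ x # x # bs) @ zs) = 0" for as x bs
    using repeat[of as x "bs @ zs"] by simp
qed

text \<open>A letter of \<open>vs\<close> can only be matched inside \<open>vs\<close>, and by
  evenness the letters of \<open>vs\<close> leave in pairs until none is left.\<close>

lemma pfw_orthogonal:
  assumes "even (length vs)" and "\<And>v z. v \<in> set vs \<Longrightarrow> z \<in> set zs \<Longrightarrow> w v z = 0"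
  shows "pfw w (vs @ zs) = pfw w vs * pfw w zs"
  using assms
proof (induction "length vs" arbitrary: vs rule: less_induct)
  case less
  show ?case
  proof (cases vs)
    case (Cons v vs')
    have "pfw w (vs @ zs) = (\<Sum>i<length vs' + length zs. (- 1) ^ i * w v ((vs' @ zs) ! i) * pfw w (delete_nth i (vs' @ zs)))"
      unfolding Cons append_Cons pfw_Cons by simp
    also have "\<dots> = (\<Sum>i<length vs'. (- 1) ^ i * w v ((vs' @ zs) ! i) * pfw w (delete_nth i (vs' @ zs)))"
      using less(3)[of v] Cons by (intro sum.mono_neutral_right) (auto simp: nth_append)
    also have "\<dots> = (\<Sum>i<length vs'. (- 1) ^ i * w v (vs' ! i) * (pfw w (delete_nth i vs') * pfw w zs))"
    proof (rule sum.cong[OF refl])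
      fix i assume i: "i \<in> {..<length vs'}"
      have "pfw w (delete_nth i vs' @ zs) = pfw w (delete_nth i vs') * pfw w zs"
        using i less(2,3) Cons set_delete_nth[of i vs']
        by (intro less(1)) (auto simp: length_delete_nth)
      then show "(- 1) ^ i * w v ((vs' @ zs) ! i) * pfw w (delete_nth i (vs' @ zs)) =
        (- 1) ^ i * w v (vs' ! i) * (pfw w (delete_nth i vs') * pfw w zs)"
        using i by (simp add: delete_nth_append nth_append)
    qed
    finally show ?thesis by (simp add: Cons pfw_Cons sum_distrib_left mult_ac)
  qed simp
qed

lemma pfw_zero_letter:
  assumes "\<And>z. z \<in> set as \<union> set bs \<Longrightarrow> w x z = 0"
  shows "pfw w (as @ x # bs) = 0"
proof -
  have "w z x = 0" if "z \<in> set as \<union> set bs" for z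
    using assms[OF that] skew[of z x] by simp
  then show ?thesis
    using pfw_linear[of "{}" as bs w x] assms by simp
qed

text \<open>\<open>x\<close> can be matched only with \<open>y\<close>, whose position behind
  \<open>x\<close> is the even number \<open>length xs\<close>; hence there is no sign.\<close>

lemma pfw_dual_ends:
  assumes "even (length xs)" and "\<And>z. z \<in> set xs \<Longrightarrow> w x z = 0" and "w x y = 1"
  shows "pfw w (x # xs @ [y]) = pfw w xs"
proof -
  have "pfw w (x # xs @ [y]) = (\<Sum>i\<in>{length xs}. (- 1) ^ i * w x ((xs @ [y]) ! i) * pfw w (delete_nth i (xs @ [y])))"
    unfolding pfw_Cons using assms by (intro sum.mono_neutral_right) (auto simp: nth_append less_Suc_eq)
  then show ?thesis using assms by (simp add: delete_nth_append)
qed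

text \<open>A row operation: the added multiples belong to letters already in the word, so their
  terms vanish by repetition. Letters cannot be added, so \<open>x'\<close> is a letter of its own
  whose form values against the rest of the word are those of the combination.\<close>

lemma pfw_add_multiples:
  assumes fin: "finite K" and K: "K \<subseteq> set as \<union> set bs"
    and "\<And>z. z \<in> set as \<union> set bs \<Longrightarrow> w x' z = w x z + (\<Sum>k\<in>K. c k * w k z)"
  shows "pfw w (as @ x' # bs) = pfw w (as @ x # bs)"
proof -
  have z: "w z x' = w z x + (\<Sum>k\<in>K. c k * w z k)" if "z \<in> set as \<union> set bs" for z
    using assms(3)[OF that] skew[of z] by (simp add: sum_negf)
  \<comment> \<open>\<open>None\<close> stands for \<open>x\<close> and \<open>Some k\<close> for an
    added letter, which keeps them apart when \<open>x\<close> itself lies in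
    \<open>K\<close>.\<close>
  have opt: "(\<Sum>b\<in>insert None (Some ` K). F b) = F None + (\<Sum>k\<in>K. F (Some k))"
    for F :: "'a option \<Rightarrow> 'r"
    using fin by (subst sum.insert) (auto simp: sum.reindex)
  have "pfw w (as @ x' # bs) = (\<Sum>b\<in>insert None (Some ` K). (case b of None \<Rightarrow> 1 | Some k \<Rightarrow> c k) *
      pfw w (as @ (case b of None \<Rightarrow> x | Some k \<Rightarrow> k) # bs))"
    by (rule pfw_linear) (use fin assms(3) z in \<open>auto simp: opt\<close>)
  also have "\<dots> = pfw w (as @ x # bs) + (\<Sum>k\<in>K. c k * pfw w (as @ k # bs))"
    by (simp add: opt)
  also have "(\<Sum>k\<in>K. c k * pfw w (as @ k # bs)) = 0"
  proof (rule sum.neutral, rule ballI)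
    fix k assume "k \<in> K"
    then have "\<not> distinct (as @ k # bs)" using K by auto
    then show "c k * pfw w (as @ k # bs) = 0" by (simp add: not_distinct)
  qed
  finally show ?thesis by simp
qed

end

lemma sum_words_Suc:
  "(\<Sum>g\<in>{g. length g = Suc m \<and> set g \<subseteq> B}. F g) = (\<Sum>b\<in>B. \<Sum>g\<in>{g. length g = m \<and> set g \<subseteq> B}. F (b # g))"
proof -
  have "(\<Sum>b\<in>B. \<Sum>g\<in>{g. length g = m \<and> set g \<subseteq> B}. F (b # g))
    = (\<Sum>(b, g)\<in>B \<times> {g. length g = m \<and> set g \<subseteq> B}. F (b # g))"
    by (rule sum.cartesian_product)
  also have "\<dots> = (\<Sum>g\<in>{g. length g = Suc m \<and> set g \<subseteq> B}. F g)"
    by (rule sum.reindex_bij_witness[of _ "\<lambda>g. (hd g, tl g)" "\<lambda>(b, g). b # g"])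
       (auto simp: length_Suc_conv)
  finally show ?thesis ..
qed

text \<open>The letters of \<open>xs\<close> are replaced one by one. Their expansions must hold
  against \<open>B\<close> too, because letters already replaced stand in the word as elements of
  \<open>B\<close>.\<close>

lemma pfw_multilinear:
  assumes fin: "finite B"
    and l: "\<And>x z. x \<in> set xs \<Longrightarrow> z \<in> set as \<union> B \<union> set xs \<union> set bs \<Longrightarrow> w x z = (\<Sum>b\<in>B. c x b * w b z)"
    and r: "\<And>x z. x \<in> set xs \<Longrightarrow> z \<in> set as \<union> B \<union> set xs \<union> set bs \<Longrightarrow> w z x = (\<Sum>b\<in>B. c x b * w z b)"
  shows "pfw w (as @ xs @ bs) =
    (\<Sum>g\<in>{g. length g = length xs \<and> set g \<subseteq> B}. (\<Prod>i<length xs. c (xs ! i) (g ! i)) * pfw w (as @ g @ bs))"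
  using l r
proof (induction xs arbitrary: as)
  case Nil
  have "{g. length g = 0 \<and> set g \<subseteq> B} = {[]}" by auto
  then show ?case by simp
next
  case (Cons x xs)
  have "pfw w (as @ x # (xs @ bs)) = (\<Sum>b\<in>B. c x b * pfw w (as @ b # (xs @ bs)))"
    by (rule pfw_linear) (use fin Cons.prems in auto)
  also have "\<dots> = (\<Sum>b\<in>B. c x b * (\<Sum>g\<in>{g. length g = length xs \<and> set g \<subseteq> B}.
      (\<Prod>i<length xs. c (xs ! i) (g ! i)) * pfw w (as @ b # g @ bs)))"
  proof (rule sum.cong[OF refl])
    fix b assume "b \<in> B"
    then have "pfw w ((as @ [b]) @ xs @ bs) = (\<Sum>g\<in>{g. length g = length xs \<and> set g \<subseteq> B}.
      (\<Prod>i<length xs. c (xs ! i) (g ! i)) * pfw w ((as @ [b]) @ g @ bs))"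
      using Cons.prems by (intro Cons.IH) auto
    then show "c x b * pfw w (as @ b # (xs @ bs)) = c x b * (\<Sum>g\<in>{g. length g = length xs \<and> set g \<subseteq> B}.
      (\<Prod>i<length xs. c (xs ! i) (g ! i)) * pfw w (as @ b # g @ bs))" by simp
  qed
  also have "\<dots> = (\<Sum>g\<in>{g. length g = length (x # xs) \<and> set g \<subseteq> B}. (\<Prod>i<length (x # xs). c ((x # xs) ! i) (g ! i)) * pfw w (as @ g @ bs))"
    by (simp add: sum_words_Suc prod.lessThan_Suc_shift sum_distrib_left mult_ac del: prod.lessThan_Suc)
  finally show ?case by simp
qed

section \<open>Inverse and minor summation\<close>

text \<open>
  \<open>U\<close>, \<open>V\<close>, \<open>Z\<close> label the rows of the block matrix of the theorem (with \<open>C\<close> as middle block). Subtracting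
  from \<open>U i\<close> its component in the span of the \<open>V\<close> gives \<open>W i\<close>, which is orthogonal to all \<open>V\<close>. For the
  form, \<open>W i\<close> is indistinguishable from the combination \<open>\<Sum>k. T i k * E k + \<Sum>j. T0 i j * F j\<close>, where the
  letters \<open>E\<close> carry the form \<open>A\<close> and \<open>F\<close> is dual to \<open>Z\<close>.
\<close>

datatype letter = U nat | W nat | V nat | Z nat | E nat | F nat

text \<open>\<open>T\<close> and \<open>T0\<close> play the roles of H(u; S) and H(u; S0),
  \<open>A\<close> and \<open>C\<close> those of the matrix and its inverse. That \<open>C\<close>
  inverts \<open>A\<close> is a hypothesis of individual lemmas, which leaves room for other choices
  of the parameters.\<close>

locale pfaffian_alphabet =
  fixes T T0 A C :: "nat \<Rightarrow> nat \<Rightarrow> 'r::comm_ring_1" and N :: nat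
  assumes alt_A: "alternating_form A" and alt_C: "alternating_form C"
begin

definition TA :: "nat \<Rightarrow> nat \<Rightarrow> 'r" where
  "TA i l = (\<Sum>k<N. T i k * A k l)"

definition TAT :: "nat \<Rightarrow> nat \<Rightarrow> 'r" where
  "TAT i j = (\<Sum>l<N. TA i l * T j l)"

text \<open>Against \<open>U\<close>, \<open>V\<close>, \<open>W\<close>, \<open>Z\<close> the
  letter \<open>W i\<close> behaves as \<open>U i\<close> minus the sum of the
  \<open>TA i k * V k\<close>; against \<open>E\<close>, \<open>F\<close>, \<open>W\<close>,
  \<open>Z\<close> as its combination of the \<open>E\<close> and \<open>F\<close>. Each description
  is applied only in words over its own letters.\<close>

fun lf :: "letter \<Rightarrow> letter \<Rightarrow> 'r" where
  "lf (U i) (V k) = T i k"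
| "lf (V k) (U i) = - T i k"
| "lf (U i) (W j) = TAT i j"
| "lf (W i) (U j) = TAT i j"
| "lf (U i) (Z j) = T0 i j"
| "lf (Z j) (U i) = - T0 i j"
| "lf (V k) (V l) = C k l"
| "lf (W i) (W j) = TAT i j"
| "lf (W i) (Z j) = T0 i j"
| "lf (Z j) (W i) = - T0 i j"
| "lf (W i) (E l) = TA i l"
| "lf (E l) (W i) = - TA i l"
| "lf (E k) (E l) = A k l"
| "lf (F j) (Z l) = of_bool (j = l)"
| "lf (Z l) (F j) = - of_bool (j = l)"
| "lf _ _ = 0"

lemma TAT_skew: "TAT i j = - TAT j i"
proof -
  interpret A: alternating_form A by (rule alt_A)
  have "TAT i j = (\<Sum>l<N. \<Sum>k<N. T i k * A k l * T j l)"
    by (simp add: TAT_def TA_def sum_distrib_right)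
  also have "\<dots> = (\<Sum>k<N. \<Sum>l<N. - (T j l * A l k * T i k))"
    by (subst sum.swap) (intro sum.cong refl, subst A.skew, simp add: mult_ac)
  also have "\<dots> = - TAT j i"
    by (simp add: TAT_def TA_def sum_distrib_right sum_negf)
  finally show ?thesis .
qed

end

text \<open>Skew symmetry of the sum alone would not suffice in characteristic 2.\<close>

lemma alternating_form_quadratic_zero:
  fixes N :: nat
  assumes "alternating_form A"
  shows "(\<Sum>k<N. \<Sum>l<N. t k * A k l * t l) = (0::'r::comm_ring_1)"
proof (induction N)
  case (Suc N)
  interpret alternating_form A by (rule assms)
  have "(\<Sum>k<N. t k * A k N * t N) = - (\<Sum>l<N. t N * A N l * t l)"
    unfolding sum_negf[symmetric] by (intro sum.cong refl) (subst skew, simp add: mult_ac)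
  then show ?case using Suc by (simp add: sum.distrib diag)
qed simp

context pfaffian_alphabet
begin

lemma TAT_diag: "TAT i i = 0"
proof -
  have "TAT i i = (\<Sum>l<N. \<Sum>k<N. T i k * A k l * T i l)"
    by (simp add: TAT_def TA_def sum_distrib_right)
  also have "\<dots> = 0"
    using alternating_form_quadratic_zero[OF alt_A] by (subst sum.swap) simp
  finally show ?thesis .
qed

sublocale alternating_form lf
proof
  interpret A: alternating_form A by (rule alt_A)
  interpret C: alternating_form C by (rule alt_C)
  show "lf x x = 0" for x
    by (cases x) (simp_all add: A.diag C.diag TAT_diag)
  show "lf x y = - lf y x" for x y
    by (cases x; cases y) (auto intro: A.skew C.skew TAT_skew)
qed

lemma pfw_lf_E: "pfw lf (map E xs) = pfw A xs"
  by (simp add: pfw_map)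

lemma pfw_lf_V: "pfw lf (map V xs) = pfw C xs"
  by (simp add: pfw_map)

text \<open>The coefficients \<open>TA i k\<close> are chosen so that T A C = T makes
  \<open>W i\<close> orthogonal to every \<open>V\<close>. Once all \<open>U\<close> are replaced,
  the even block of the \<open>V\<close> moves to the front without a sign and splits off.\<close>

lemma pfw_Schur_complement:
  assumes inv: "\<And>i l. i < N \<Longrightarrow> l < N \<Longrightarrow> (\<Sum>k<N. A i k * C k l) = of_bool (i = l)"
    and vs: "set vs = {..<N}" "even (length vs)" and zs: "set zs \<subseteq> range Z"
  shows "pfw lf (map U [0..<m] @ map V vs @ zs) = pfw C vs * pfw lf (map W [0..<m] @ zs)"
proof -
  have rel: "lf (W i) z = lf (U i) z + (\<Sum>k\<in>V ` {..<N}. (case k of V k \<Rightarrow> - TA i k | _ \<Rightarrow> 0) * lf k z)"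
    if "z \<in> range U \<union> range W \<union> V ` {..<N} \<union> range Z" for i z
  proof -
    have sum: "(\<Sum>k\<in>V ` {..<N}. (case k of V k \<Rightarrow> - TA i k | _ \<Rightarrow> 0) * lf k z) = (\<Sum>k<N. - TA i k * lf (V k) z)"
      by (subst sum.reindex) (auto simp: inj_on_def)
    have V: "(\<Sum>k<N. TA i k * C k l) = T i l" if l: "l < N" for l
    proof -
      have "(\<Sum>k<N. TA i k * C k l) = (\<Sum>k<N. \<Sum>j<N. T i j * (A j k * C k l))"
        by (simp add: TA_def sum_distrib_left sum_distrib_right mult_ac)
      also have "\<dots> = (\<Sum>j<N. T i j * of_bool (j = l))"
        by (subst sum.swap) (simp add: inv l flip: sum_distrib_left)
      also have "\<dots> = T i l" using l by (simp add: of_bool_def if_distrib sum.delta cong: if_cong)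
      finally show ?thesis .
    qed
    show ?thesis
      unfolding sum using that V by (auto simp: TAT_def sum_negf)
  qed
  have "pfw lf (map W [0..<i] @ map U [i..<m] @ map V vs @ zs) = pfw lf (map U [0..<m] @ map V vs @ zs)"
    if "i \<le> m" for i
    using that
  proof (induction i)
    case (Suc i)
    have split: "[i..<m] = i # [Suc i..<m]" using Suc.prems by (simp add: upt_conv_Cons)
    have "pfw lf (map W [0..<i] @ W i # map U [Suc i..<m] @ map V vs @ zs)
        = pfw lf (map W [0..<i] @ U i # map U [Suc i..<m] @ map V vs @ zs)"
    proof (rule pfw_add_multiples[where K = "V ` {..<N}"])
      show "V ` {..<N} \<subseteq> set (map W [0..<i]) \<union> set (map U [Suc i..<m] @ map V vs @ zs)"
        using vs by auto
      fix z assume "z \<in> set (map W [0..<i]) \<union> set (map U [Suc i..<m] @ map V vs @ zs)"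
      then have "z \<in> range U \<union> range W \<union> V ` {..<N} \<union> range Z" using vs zs by auto
      then show "lf (W i) z = lf (U i) z + (\<Sum>k\<in>V ` {..<N}. (case k of V k \<Rightarrow> - TA i k | _ \<Rightarrow> 0) * lf k z)"
        by (rule rel)
    qed simp
    then show ?case using Suc by (simp add: split)
  qed simp
  from this[of m] have "pfw lf (map U [0..<m] @ map V vs @ zs) = pfw lf (map W [0..<m] @ map V vs @ zs)"
    by simp
  also have "\<dots> = pfw lf (map V vs @ map W [0..<m] @ zs)"
    using move_even_block[of "map V vs" "[]" "map W [0..<m]" zs] vs by simp
  also have "\<dots> = pfw lf (map V vs) * pfw lf (map W [0..<m] @ zs)"
    using vs zs by (intro pfw_orthogonal) auto
  finally show ?thesis by (simp only: pfw_lf_V)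
qed

text \<open>In this word \<open>F a\<close> pairs only with \<open>Z a\<close>, and the reversed
  order of the \<open>Z\<close> nests the pairs, so that they can be stripped from the
  outside.\<close>

lemma pfw_dual_FZ:
  assumes "distinct ws" "even (length es)" "set es \<subseteq> range E"
  shows "pfw lf (map F ws @ es @ map Z (rev ws)) = pfw lf es"
  using assms(1)
proof (induction ws)
  case (Cons a ws)
  have "pfw lf (F a # (map F ws @ es @ map Z (rev ws)) @ [Z a]) = pfw lf (map F ws @ es @ map Z (rev ws))"
    by (rule pfw_dual_ends) (use Cons assms in auto)
  then show ?case using Cons by simp
qed simp

definition coord :: "letter \<Rightarrow> letter \<Rightarrow> 'r" where
  "coord x b = (case x of W i \<Rightarrow> (case b of F j \<Rightarrow> T0 i j | E k \<Rightarrow> T i k | _ \<Rightarrow> 0) | _ \<Rightarrow> 0)"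

lemma coord_simps [simp]:
  "coord (W i) (F j) = T0 i j" "coord (W i) (E k) = T i k"
  by (simp_all add: coord_def)

text \<open>Against all letters that occur, \<open>W i\<close> takes the values of its combination
  of the \<open>F\<close> and \<open>E\<close>, so the word expands in these letters.
  \<open>L\<close> lists \<open>F\<close> before \<open>E\<close>, which puts the columns for S0
  first in each determinant.\<close>

lemma pfw_minor_expansion:
  fixes m n :: nat
  defines "L \<equiv> map F [0..<n] @ map E [0..<N]" and "zs \<equiv> map Z (rev [0..<n])"
  shows "pfw lf (map W [0..<m] @ zs) = (\<Sum>K\<in>{K. K \<subseteq> set L \<and> card K = m}.
    pfw lf (filter (\<lambda>b. b \<in> K) L @ zs) * det (mat m m (\<lambda>(i, j). coord (W i) (filter (\<lambda>b. b \<in> K) L ! j))))"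
proof -
  interpret g: alternating_words "\<lambda>g. pfw lf (g @ zs)" by (rule alternating_words_append)
  have dL: "distinct L" by (auto simp: L_def distinct_map inj_on_def)
  have setL: "set L = F ` {..<n} \<union> E ` {..<N}" by (auto simp: L_def)
  have l: "lf (W i) z = (\<Sum>b\<in>set L. coord (W i) b * lf b z)"
    if "z \<in> set L \<union> set (map W [0..<m]) \<union> set zs" for i z
  proof -
    have "(\<Sum>b\<in>set L. coord (W i) b * lf b z) =
      (\<Sum>j<n. T0 i j * lf (F j) z) + (\<Sum>k<N. T i k * lf (E k) z)"
      unfolding setL by (subst sum.union_disjoint) (auto simp: sum.reindex inj_on_def)
    also have "\<dots> = lf (W i) z"
    proof (cases z)
      case (W j)
      then show ?thesis
        using TAT_skew[of i j] by (simp add: TAT_def[of j i] sum_negf mult.commute)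
    next
      case (Z j)
      then have "j < n" using that by (auto simp: setL zs_def)
      then show ?thesis
        using Z by (simp add: of_bool_def if_distrib sum.delta cong: if_cong)
    next
      case (E l)
      then show ?thesis by (simp add: TA_def)
    qed (use that in \<open>auto simp: setL zs_def\<close>)
    finally show ?thesis ..
  qed
  have r: "lf z (W i) = (\<Sum>b\<in>set L. coord (W i) b * lf z b)"
    if "z \<in> set L \<union> set (map W [0..<m]) \<union> set zs" for i z
    using l[OF that, of i] skew[of z] by (simp add: sum_negf)
  have "pfw lf ([] @ map W [0..<m] @ zs) =
    (\<Sum>g\<in>{g. length g = length (map W [0..<m]) \<and> set g \<subseteq> set L}.
      (\<Prod>i<length (map W [0..<m]). coord (map W [0..<m] ! i) (g ! i)) * pfw lf ([] @ g @ zs))"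
  proof (rule pfw_multilinear)
    fix x z assume x: "x \<in> set (map W [0..<m])"
      and "z \<in> set [] \<union> set L \<union> set (map W [0..<m]) \<union> set zs"
    then have z: "z \<in> set L \<union> set (map W [0..<m]) \<union> set zs" by simp
    obtain i where "x = W i" using x by auto
    then show "lf x z = (\<Sum>b\<in>set L. coord x b * lf b z)" "lf z x = (\<Sum>b\<in>set L. coord x b * lf z b)"
      using l[OF z] r[OF z] by blast+
  qed simp
  also have "\<dots> = (\<Sum>g\<in>{g. length g = m \<and> set g \<subseteq> set L}. (\<Prod>i<m. coord (W i) (g ! i)) * pfw lf (g @ zs))"
    by simp
  also have "\<dots> = (\<Sum>K\<in>{K. K \<subseteq> set L \<and> card K = m}.
    pfw lf (filter (\<lambda>b. b \<in> K) L @ zs) * det (mat m m (\<lambda>(i, j). coord (W i) (filter (\<lambda>b. b \<in> K) L ! j))))"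
    by (rule g.Cauchy_Binet[OF dL])
  finally show ?thesis by simp
qed

text \<open>In the expanded words \<open>Z j\<close> pairs only with \<open>F j\<close>, so only
  sets \<open>K\<close> containing all the \<open>F\<close> survive. The \<open>E\<close> letters of
  such a \<open>K\<close> form the set \<open>I\<close>, and stripping the dual pairs leaves the
  subpfaffian of \<open>A\<close> on \<open>I\<close>.\<close>

lemma pfw_minor_summation:
  assumes nm: "n \<le> m" "even (m - n)"
  shows "pfw lf (map W [0..<m] @ map Z (rev [0..<n])) = (\<Sum>I\<in>{I. I \<subseteq> {..<N} \<and> card I = m - n}.
    pfw A (filter (\<lambda>k. k \<in> I) [0..<N]) *
      det (mat m m (\<lambda>(i, j). if j < n then T0 i j else T i (filter (\<lambda>k. k \<in> I) [0..<N] ! (j - n)))))"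
proof -
  let ?zs = "map Z (rev [0..<n])" and ?L = "map F [0..<n] @ map E [0..<N]"
  let ?t = "\<lambda>K. pfw lf (filter (\<lambda>b. b \<in> K) ?L @ ?zs) *
    det (mat m m (\<lambda>(i, j). coord (W i) (filter (\<lambda>b. b \<in> K) ?L ! j)))"
  let ?Ks = "{K. K \<subseteq> set ?L \<and> card K = m}" and ?Is = "{I. I \<subseteq> {..<N} \<and> card I = m - n}"
  have zero: "pfw lf (filter (\<lambda>b. b \<in> K) ?L @ ?zs) = 0" if "j < n" "F j \<notin> K" for K j
  proof -
    have "Z j \<in> set ?zs" using that by auto
    then obtain z1 z2 where z: "?zs = z1 @ Z j # z2" by (meson split_list)
    have "set z1 \<union> set z2 \<subseteq> range Z" using arg_cong[OF z, of set] by auto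
    then have "lf (Z j) x = 0" if "x \<in> set (filter (\<lambda>b. b \<in> K) ?L @ z1) \<union> set z2" for x
      using that \<open>F j \<notin> K\<close> by (fastforce split: letter.splits)
    then have "pfw lf ((filter (\<lambda>b. b \<in> K) ?L @ z1) @ Z j # z2) = 0"
      by (rule pfw_zero_letter)
    then show ?thesis unfolding z by simp
  qed
  have inj: "inj_on (\<lambda>I. F ` {..<n} \<union> E ` I) ?Is"
    by (rule inj_onI) (auto simp: set_eq_iff image_iff)
  have "pfw lf (map W [0..<m] @ ?zs) = (\<Sum>K\<in>?Ks. ?t K)"
    by (rule pfw_minor_expansion)
  also have "\<dots> = (\<Sum>K\<in>(\<lambda>I. F ` {..<n} \<union> E ` I) ` ?Is. ?t K)"
  proof (rule sum.mono_neutral_right)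
    show "finite ?Ks" by (rule finite_subset[of _ "Pow (set ?L)"]) auto
    show "(\<lambda>I. F ` {..<n} \<union> E ` I) ` ?Is \<subseteq> ?Ks"
    proof safe
      fix I assume I: "I \<subseteq> {..<N}" "card I = m - n"
      then have "finite I" using finite_subset by blast
      then have "card (F ` {..<n} \<union> E ` I) = n + card I"
        by (subst card_Un_disjoint) (auto simp: card_image inj_on_def)
      then show "card (F ` {..<n} \<union> E ` I) = m" using I nm by simp
    qed auto
    show "\<forall>K\<in>?Ks - (\<lambda>I. F ` {..<n} \<union> E ` I) ` ?Is. ?t K = 0"
    proof
      fix K assume K: "K \<in> ?Ks - (\<lambda>I. F ` {..<n} \<union> E ` I) ` ?Is"
      have "\<exists>j<n. F j \<notin> K"
      proof (rule ccontr)
        assume "\<not> (\<exists>j<n. F j \<notin> K)"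
        moreover define I where "I = {k. E k \<in> K}"
        ultimately have eq: "K = F ` {..<n} \<union> E ` I" using K by auto
        have I: "I \<subseteq> {..<N}" using K by (auto simp: I_def)
        then have "finite I" using finite_subset by blast
        then have "card (F ` {..<n} \<union> E ` I) = n + card I"
          by (subst card_Un_disjoint) (auto simp: card_image inj_on_def)
        moreover have "card (F ` {..<n} \<union> E ` I) = m" using K unfolding eq by blast
        ultimately have "card I = m - n" by simp
        then show False using K I eq by auto
      qed
      then show "?t K = 0" using zero by auto
    qed
  qed
  also have "\<dots> = (\<Sum>I\<in>?Is. ?t (F ` {..<n} \<union> E ` I))"
    using inj by (simp add: sum.reindex)
  also have "\<dots> = (\<Sum>I\<in>?Is. pfw A (filter (\<lambda>k. k \<in> I) [0..<N]) *
      det (mat m m (\<lambda>(i, j). if j < n then T0 i j else T i (filter (\<lambda>k. k \<in> I) [0..<N] ! (j - n)))))"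
  proof (rule sum.cong[OF refl])
    fix I assume "I \<in> ?Is"
    then have I: "I \<subseteq> {..<N}" "card I = m - n" by auto
    let ?I = "filter (\<lambda>k. k \<in> I) [0..<N]"
    have len: "length ?I = m - n"
      using I distinct_card[of ?I] by (auto simp: Int_absorb1 Int_def[symmetric] lessThan_def subset_iff Collect_conj_eq)
    have fil: "filter (\<lambda>b. b \<in> F ` {..<n} \<union> E ` I) ?L = map F [0..<n] @ map E ?I"
      by (auto simp: filter_map o_def image_iff intro!: filter_True)
    have "pfw lf (map F [0..<n] @ map E ?I @ map Z (rev [0..<n])) = pfw lf (map E ?I)"
      by (rule pfw_dual_FZ) (use len nm in auto)
    moreover have "mat m m (\<lambda>(i, j). coord (W i) ((map F [0..<n] @ map E ?I) ! j)) =
      mat m m (\<lambda>(i, j). if j < n then T0 i j else T i (?I ! (j - n)))"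
      using len by (intro eq_matI) (auto simp: nth_append)
    ultimately show "?t (F ` {..<n} \<union> E ` I) = pfw A ?I *
      det (mat m m (\<lambda>(i, j). if j < n then T0 i j else T i (?I ! (j - n))))"
      unfolding fil by (simp add: pfw_lf_E)
  qed
  finally show ?thesis .
qed

end

text \<open>
  With \<open>T\<close> the identity, \<open>n = 0\<close> and \<open>m = N\<close> the block matrix has Pfaffian 1, so the Schur complement
  formula itself gives the Pfaffian of the inverse; no \<open>Pf\<^sup>2 = det\<close> is needed.
\<close>

lemma pfw_inverse:
  assumes "alternating_form A" "alternating_form C" "even N"
    and inv: "\<And>i l. i < N \<Longrightarrow> l < N \<Longrightarrow> (\<Sum>k<N. A i k * C k l) = of_bool (i = l)"
  shows "pfw C (rev [0..<N]) * pfw A [0..<N] = 1"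
proof -
  interpret pfaffian_alphabet "\<lambda>i k. of_bool (i = k)" "\<lambda>_ _. 0" A C N
    by (rule pfaffian_alphabet.intro) (rule assms)+
  have TA: "TA i l = A i l" if "i < N" for i l
    unfolding TA_def using that by (simp add: of_bool_def if_distrib if_distribR sum.delta cong: if_cong)
  have TAT: "TAT i j = A i j" if "i < N" "j < N" for i j
    unfolding TAT_def TA[OF that(1)] using that
    by (simp add: of_bool_def if_distrib sum.delta cong: if_cong)
  have dual: "pfw lf (map U ws @ map V (rev ws)) = 1" if "distinct ws" for ws
    using that
  proof (induction ws)
    case (Cons a ws)
    have "pfw lf (U a # (map U ws @ map V (rev ws)) @ [V a]) = pfw lf (map U ws @ map V (rev ws))"
      by (rule pfw_dual_ends) (use Cons in auto)
    then show ?case using Cons by simp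
  qed simp
  have "1 = pfw lf (map U [0..<N] @ map V (rev [0..<N]) @ [])"
    using dual[of "[0..<N]"] by simp
  also have "\<dots> = pfw C (rev [0..<N]) * pfw lf (map W [0..<N] @ [])"
    by (rule pfw_Schur_complement) (use assms in auto)
  also have "pfw lf (map W [0..<N] @ []) = pfw A [0..<N]"
    by (auto simp: pfw_map TAT intro!: pfw_cong)
  finally show ?thesis ..
qed

text \<open>The Schur complement splits off \<open>pfw C (rev [0..<N])\<close>, whose product with
  \<open>pfw A [0..<N]\<close> is 1; thus the formula holds over every commutative ring without
  division.\<close>

theorem pfw_inverse_minor_summation:
  fixes T T0 A C :: "nat \<Rightarrow> nat \<Rightarrow> 'r::comm_ring_1"
  assumes "alternating_form A" "alternating_form C" "even N" "n \<le> m" "even (m - n)"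
    and inv: "\<And>i l. i < N \<Longrightarrow> l < N \<Longrightarrow> (\<Sum>k<N. A i k * C k l) = of_bool (i = l)"
  shows "pfw A [0..<N] *
      pfw (pfaffian_alphabet.lf T T0 A C N) (map U [0..<m] @ map V (rev [0..<N]) @ map Z (rev [0..<n]))
    = (\<Sum>I\<in>{I. I \<subseteq> {..<N} \<and> card I = m - n}. pfw A (filter (\<lambda>k. k \<in> I) [0..<N]) *
      det (mat m m (\<lambda>(i, j). if j < n then T0 i j else T i (filter (\<lambda>k. k \<in> I) [0..<N] ! (j - n)))))"
proof -
  interpret pfaffian_alphabet T T0 A C N
    by (rule pfaffian_alphabet.intro) (rule assms)+
  have "pfw lf (map U [0..<m] @ map V (rev [0..<N]) @ map Z (rev [0..<n]))
     = pfw C (rev [0..<N]) * pfw lf (map W [0..<m] @ map Z (rev [0..<n]))"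
    by (rule pfw_Schur_complement) (use assms in auto)
  then have "pfw A [0..<N] * pfw lf (map U [0..<m] @ map V (rev [0..<N]) @ map Z (rev [0..<n]))
    = pfw C (rev [0..<N]) * pfw A [0..<N] * pfw lf (map W [0..<m] @ map Z (rev [0..<n]))"
    by (simp only: mult_ac)
  then show ?thesis
    using pfw_inverse[OF assms(1,2,3) inv] pfw_minor_summation[OF assms(4,5)] by simp
qed

section \<open>Non-intersecting paths\<close>

text \<open>Terms of sign 1 are matched bijectively with terms of sign -1, since comparing the sum
  with its own negative would leave a factor 2.\<close>

lemma sum_sign_reversing_involution:
  fixes f :: "'b \<Rightarrow> 'r::comm_ring_1" and s :: "'b \<Rightarrow> int"
  assumes "\<And>x. x \<in> X \<Longrightarrow> \<phi> x \<in> X" "\<And>x. x \<in> X \<Longrightarrow> \<phi> (\<phi> x) = x"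
    and "\<And>x. x \<in> X \<Longrightarrow> s x = 1 \<or> s x = - 1" "\<And>x. x \<in> X \<Longrightarrow> s (\<phi> x) = - s x"
    and "\<And>x. x \<in> X \<Longrightarrow> f (\<phi> x) = f x"
  shows "(\<Sum>x\<in>X. of_int (s x) * f x) = 0"
proof (cases "finite X")
  case True
  have "(\<Sum>x\<in>{x \<in> X. s x = 1}. f x) = (\<Sum>x\<in>{x \<in> X. s x \<noteq> 1}. f x)"
    by (rule sum.reindex_bij_witness[of _ \<phi> \<phi>]) (use assms in force)+
  moreover have "(\<Sum>x\<in>X. of_int (s x) * f x) =
      (\<Sum>x\<in>{x \<in> X. s x = 1}. of_int (s x) * f x) + (\<Sum>x\<in>{x \<in> X. s x \<noteq> 1}. of_int (s x) * f x)"
    using True by (subst sum.union_disjoint[symmetric]) (auto intro: sum.cong)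
  moreover have "(\<Sum>x\<in>{x \<in> X. s x = 1}. of_int (s x) * f x) = (\<Sum>x\<in>{x \<in> X. s x = 1}. f x)"
    by (intro sum.cong) auto
  moreover have "(\<Sum>x\<in>{x \<in> X. s x \<noteq> 1}. of_int (s x) * f x) = - (\<Sum>x\<in>{x \<in> X. s x \<noteq> 1}. f x)"
    unfolding sum_negf[symmetric] by (intro sum.cong) (auto dest!: assms(3))
  ultimately show ?thesis by simp
qed simp

section \<open>Walks in an acyclic digraph\<close>

locale finite_path_digraph = wf_digraph D for D :: "('v, 'e) pre_digraph" +
  assumes acyclic: "acyclic_digraph D"
    and finite_paths: "v \<in> verts D \<Longrightarrow> w \<in> verts D \<Longrightarrow> finite (paths D v w)"
begin

lemma closed_awalk_Nil:
  assumes "awalk x p x" shows "p = []"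
proof (rule ccontr)
  assume "p \<noteq> []"
  then have "closed_w p" using assms by (auto simp: closed_w_def)
  then show False using closed_w_imp_cycle acyclic by (auto simp: acyclic_digraph_def)
qed

text \<open>A walk that repeats a vertex contains a nonempty closed walk. Hence cutting and joining
  walks never leaves the set of paths, on which the exchange of initial parts relies.\<close>

lemma paths_iff: "p \<in> paths D u v \<longleftrightarrow> awalk u p v"
proof -
  have "distinct (awalk_verts u p)" if p: "awalk u p v"
  proof (rule ccontr)
    assume "\<not> distinct (awalk_verts u p)"
    then obtain r x where "0 < length r" "awalk x r x"
      using awalk_not_distinct_decomp[OF p] by blast
    then show False using closed_awalk_Nil by auto
  qed
  then show ?thesis by (auto simp: paths_def apath_def)
qed

lemma finite_paths': "finite (paths D u v)"
proof (cases "u \<in> verts D \<and> v \<in> verts D")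
  case False
  then have "paths D u v = {}" by (auto simp: paths_iff)
  then show ?thesis by simp
qed (simp add: finite_paths)

text \<open>Acyclicity makes reachability a partial order, so that which of two vertices comes later
  does not depend on the path along which they are compared.\<close>

definition leads_to :: "'v \<Rightarrow> 'v \<Rightarrow> bool" where
  "leads_to x y \<longleftrightarrow> (\<exists>p. awalk x p y)"

lemma leads_to_antisym:
  assumes "leads_to x y" "leads_to y x" shows "x = y"
proof -
  obtain p q where p: "awalk x p y" and q: "awalk y q x" using assms by (auto simp: leads_to_def)
  then have "p @ q = []" by (intro closed_awalk_Nil) (rule awalk_appendI)
  then show ?thesis using p by (simp add: awalk_Nil_iff)
qed

lemma path_verts_leads_to:
  assumes "awalk u p v" "x \<in> path_verts D u p"
  shows "leads_to u x" "leads_to x v"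
  using awalk_decomp[OF assms(1), of x] assms(2) by (auto simp: path_verts_def leads_to_def)

lemma path_verts_append:
  assumes "awalk u a x" "awalk x b v"
  shows "path_verts D u (a @ b) = path_verts D u a \<union> path_verts D x b"
  using set_awalk_verts_append[OF assms] by (simp add: path_verts_def)

lemma path_verts_ends:
  assumes "awalk u p v" shows "u \<in> path_verts D u p" "v \<in> path_verts D u p"
  using assms by (auto simp: path_verts_def hd_in_awalk_verts)

text \<open>Along a path each vertex leads to all later ones, so the last vertex that lies in
  \<open>M\<close> is greatest.\<close>

lemma path_verts_greatest:
  assumes "awalk u p v" "M \<subseteq> path_verts D u p" "M \<noteq> {}"
  shows "\<exists>x\<in>M. \<forall>y\<in>M. leads_to y x"
  using assms
proof (induction p arbitrary: u M)
  case Nil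
  then have "M = {u}" "awalk u [] u" by (auto simp: path_verts_def awalk_Nil_iff)
  then show ?case by (auto simp: leads_to_def)
next
  case (Cons e p)
  then have e: "e \<in> arcs D" "tail D e = u" and p: "awalk (head D e) p v"
    by (auto simp: awalk_Cons_iff)
  have sub: "M \<subseteq> insert u (path_verts D (head D e) p)"
    using Cons.prems e by (auto simp: path_verts_def)
  show ?case
  proof (cases "M \<inter> path_verts D (head D e) p = {}")
    case True
    then have "M = {u}" using sub Cons.prems(3) by auto
    moreover have "awalk u [] u" using e by (auto simp: awalk_Nil_iff)
    ultimately show ?thesis by (auto simp: leads_to_def)
  next
    case False
    then obtain x where x: "x \<in> M \<inter> path_verts D (head D e) p"
      and le: "\<And>y. y \<in> M \<inter> path_verts D (head D e) p \<Longrightarrow> leads_to y x"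
      using Cons.IH[OF p] by (meson Int_lower2)
    obtain q where "awalk (head D e) q x"
      using path_verts_leads_to[OF p] x by (auto simp: leads_to_def)
    then have "leads_to u x" using e by (auto simp: leads_to_def awalk_Cons_iff intro!: exI[of _ "e # q"])
    then show ?thesis using x le sub by blast
  qed
qed

definition init_part :: "'v \<Rightarrow> 'e list \<Rightarrow> 'v \<Rightarrow> 'e list" where
  "init_part u p x = (SOME a. \<exists>b. p = a @ b \<and> awalk u a x)"

definition final_part :: "'v \<Rightarrow> 'e list \<Rightarrow> 'v \<Rightarrow> 'e list" where
  "final_part u p x = drop (length (init_part u p x)) p"

text \<open>Two prefixes with the same end differ by a closed walk, which acyclicity makes empty.
  This determines the choice in \<open>init_part\<close>.\<close>

lemma awalk_prefix_unique:
  assumes "a @ b = a' @ b'" "awalk u a x" "awalk u a' x"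
  shows "a = a'"
proof -
  have aux: "c = []" if "awalk u (a @ c) x" "awalk u a x" for a c
    using that closed_awalk_Nil[of x c] by auto
  from assms(1) obtain c where "a = a' @ c \<or> a @ c = a'"
    by (auto simp: append_eq_append_conv2)
  then show ?thesis using aux[of a c] aux[of a' c] assms(2,3) by auto
qed

lemma init_final_append:
  assumes "awalk u a x" "awalk x b v"
  shows "init_part u (a @ b) x = a" "final_part u (a @ b) x = b"
proof -
  have "\<exists>b'. a @ b = init_part u (a @ b) x @ b' \<and> awalk u (init_part u (a @ b) x) x"
    unfolding init_part_def by (rule someI_ex) (use assms in blast)
  then show "init_part u (a @ b) x = a"
    using awalk_prefix_unique assms(1) by metis
  then show "final_part u (a @ b) x = b" by (simp add: final_part_def)
qed

lemma init_final_part: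
  assumes "awalk u p v" "x \<in> path_verts D u p"
  shows "p = init_part u p x @ final_part u p x"
    and "awalk u (init_part u p x) x" and "awalk x (final_part u p x) v"
proof -
  obtain a b where "p = a @ b" "awalk u a x" "awalk x b v"
    using awalk_decomp[OF assms(1), of x] assms(2) by (auto simp: path_verts_def)
  then show "p = init_part u p x @ final_part u p x"
    "awalk u (init_part u p x) x" "awalk x (final_part u p x) v"
    using init_final_append by auto
qed

text \<open>The place where two paths of an intersecting family exchange their initial parts: \<open>i\<close> is the
  first path that meets another one, \<open>x\<close> the last vertex at which it does so, and \<open>j\<close> the first
  other path through \<open>x\<close>. Everything after \<open>x\<close> on path \<open>i\<close> survives the exchange, which makes it
  an involution.\<close>

definition crossing :: "nat \<Rightarrow> (nat \<Rightarrow> 'v set) \<Rightarrow> nat \<Rightarrow> 'v \<Rightarrow> nat \<Rightarrow> bool" where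
  "crossing m Q i x j \<longleftrightarrow> i < m \<and> j < m \<and> j \<noteq> i \<and> x \<in> Q i \<and> x \<in> Q j \<and>
     (\<forall>k<i. \<forall>l<m. l \<noteq> k \<longrightarrow> Q k \<inter> Q l = {}) \<and>
     (\<forall>l<m. l \<noteq> i \<longrightarrow> x \<in> Q l \<longrightarrow> j \<le> l) \<and>
     (\<forall>y\<in>Q i. \<forall>l<m. l \<noteq> i \<longrightarrow> y \<in> Q l \<longrightarrow> leads_to y x)"

text \<open>Each component is extremal given the previous ones: least \<open>i\<close>, greatest
  \<open>x\<close>, least \<open>j\<close>, with antisymmetry of reachability for \<open>x\<close>.
  Uniqueness ensures that a second exchange happens at the same place.\<close>

lemma crossing_unique:
  assumes "crossing m Q i x j" "crossing m Q i' x' j'"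
  shows "i' = i \<and> x' = x \<and> j' = j"
proof -
  have "\<not> i < i'" if "crossing m Q i x j" "crossing m Q i' x' j'" for i x j i' x' j'
    using that unfolding crossing_def by blast
  then have i: "i' = i" using assms by (meson linorder_neqE_nat)
  have last: "leads_to x' x" if "crossing m Q i x j" "crossing m Q i x' j'" for x j x' j'
    using that unfolding crossing_def by blast
  have first: "j \<le> j'" if "crossing m Q i x j" "crossing m Q i x j'" for j j'
    using that unfolding crossing_def by blast
  have x: "x' = x" using assms i last leads_to_antisym by metis
  then have "j' = j" using assms i first order_antisym by metis
  then show ?thesis using i x by simp
qed

lemma crossing_exists:
  assumes "k < m" "l < m" "k \<noteq> l" "Q k \<inter> Q l \<noteq> {}"
    and great: "\<And>i M. i < m \<Longrightarrow> M \<subseteq> Q i \<Longrightarrow> M \<noteq> {} \<Longrightarrow> \<exists>x\<in>M. \<forall>y\<in>M. leads_to y x"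
  shows "\<exists>i x j. crossing m Q i x j"
proof -
  define B where "B i \<longleftrightarrow> i < m \<and> (\<exists>l<m. l \<noteq> i \<and> Q i \<inter> Q l \<noteq> {})" for i
  define i where "i = (LEAST i. B i)"
  have "B k" using assms by (auto simp: B_def)
  then have B: "B i" unfolding i_def by (rule LeastI)
  have min: "\<not> B k" if "k < i" for k using that not_less_Least unfolding i_def by blast
  define M where "M = {y \<in> Q i. \<exists>l<m. l \<noteq> i \<and> y \<in> Q l}"
  have "M \<subseteq> Q i" "M \<noteq> {}" "i < m" using B by (auto simp: M_def B_def)
  then obtain x where x: "x \<in> M" "\<forall>y\<in>M. leads_to y x" using great by metis
  define j where "j = (LEAST l. l < m \<and> l \<noteq> i \<and> x \<in> Q l)"
  have "\<exists>l. l < m \<and> l \<noteq> i \<and> x \<in> Q l" using x by (auto simp: M_def)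
  then have j: "j < m \<and> j \<noteq> i \<and> x \<in> Q j" unfolding j_def by (rule LeastI_ex)
  have jmin: "j \<le> l" if "l < m" "l \<noteq> i" "x \<in> Q l" for l
    unfolding j_def using that by (intro Least_le) auto
  have "crossing m Q i x j"
    unfolding crossing_def
  proof (intro conjI allI impI ballI)
    fix k l assume "k < i" "l < m" "l \<noteq> k"
    then show "Q k \<inter> Q l = {}" using min[of k] \<open>i < m\<close> by (auto simp: B_def)
  qed (use x j jmin \<open>i < m\<close> in \<open>auto simp: M_def\<close>)
  then show ?thesis by blast
qed

text \<open>Here \<open>a\<close>, \<open>b\<close> and \<open>c\<close>, \<open>d\<close> are the
  parts of the paths \<open>i\<close> and \<open>j\<close> before and after \<open>x\<close>. The
  union of the two paths is unchanged, so earlier paths still meet no other. A meeting on the new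
  path \<open>i\<close> outside \<open>a\<close> and \<open>c\<close> lies on \<open>b\<close> and
  existed before the exchange.\<close>

lemma crossing_exchange:
  assumes Q: "crossing m Q i x j" and "Q i = a \<union> b" "Q j = c \<union> d"
    and "Q' i = c \<union> b" "Q' j = a \<union> d" and eq: "\<And>k. k < m \<Longrightarrow> k \<noteq> i \<Longrightarrow> k \<noteq> j \<Longrightarrow> Q' k = Q k"
    and "x \<in> a" "x \<in> b" "x \<in> c" "x \<in> d" and le: "\<And>y. y \<in> a \<union> c \<Longrightarrow> leads_to y x"
  shows "crossing m Q' i x j"
proof -
  have ij: "i < m" "j < m" "j \<noteq> i" "x \<in> Q i" "x \<in> Q j"
    and min: "\<And>k l. k < i \<Longrightarrow> l < m \<Longrightarrow> l \<noteq> k \<Longrightarrow> Q k \<inter> Q l = {}"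
    and jmin: "\<And>l. l < m \<Longrightarrow> l \<noteq> i \<Longrightarrow> x \<in> Q l \<Longrightarrow> j \<le> l"
    and last: "\<And>y l. y \<in> Q i \<Longrightarrow> l < m \<Longrightarrow> l \<noteq> i \<Longrightarrow> y \<in> Q l \<Longrightarrow> leads_to y x"
    using Q unfolding crossing_def by blast+
  \<comment> \<open>Otherwise \<open>j\<close> would be an earlier path that meets another
    one.\<close>
  have "i < j" using min[of j i] ij by (metis IntI empty_iff linorder_neqE_nat)
  show ?thesis
    unfolding crossing_def
  proof (intro conjI allI impI ballI)
    fix k l assume k: "k < i" "l < m" "l \<noteq> k"
    then have "Q' k = Q k" using eq[of k] \<open>i < j\<close> ij by simp
    moreover have "Q k \<inter> Q i = {}" "Q k \<inter> Q j = {}" "Q k \<inter> Q l = {}"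
      using min[of k] k \<open>i < j\<close> ij by auto
    moreover have "Q' l \<subseteq> Q i \<union> Q j \<union> Q l"
      using eq[of l] k assms(2-5) by (cases "l = i"; cases "l = j") auto
    ultimately show "Q' k \<inter> Q' l = {}" by blast
  next
    fix l assume l: "l < m" "l \<noteq> i" "x \<in> Q' l"
    then show "j \<le> l" using jmin[of l] eq[of l] by (cases "l = j") auto
  next
    fix y l assume y: "y \<in> Q' i" "l < m" "l \<noteq> i" "y \<in> Q' l"
    show "leads_to y x"
    proof (cases "y \<in> a \<union> c")
      case False
      then have "y \<in> Q i" using y assms(2-5) by auto
      moreover have "y \<in> Q l" using False y eq[of l] assms(2-5) by (cases "l = j") auto
      ultimately show ?thesis using last y by blast
    qed (rule le)
  qed (use ij assms in auto)
qed

lemma sum_n_paths: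
  assumes "length us = length vs"
  shows "finite (n_paths D us vs)"
    and "(\<Sum>P\<in>n_paths D us vs. n_path_wt x P) = (\<Prod>i<length us. h D x (us ! i) (vs ! i))"
  using assms
proof (induction us vs rule: list_induct2)
  case Nil
  have "n_paths D [] [] = {[]}" by (auto simp: n_paths_def)
  then show "finite (n_paths D [] [])"
    and "(\<Sum>P\<in>n_paths D [] []. n_path_wt x P) = (\<Prod>i<length []. h D x ([] ! i) ([] ! i))"
    by (simp_all add: n_path_wt_def)
next
  case (Cons u us v vs)
  have eq: "n_paths D (u # us) (v # vs) = (\<lambda>(p, P). p # P) ` (paths D u v \<times> n_paths D us vs)"
  proof (intro equalityI subsetI)
    fix P assume P: "P \<in> n_paths D (u # us) (v # vs)"
    then obtain p P' where "P = p # P'" by (auto simp: n_paths_def length_Suc_conv)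
    moreover from this have "p \<in> paths D u v" using P by (auto simp: n_paths_def)
    moreover have "P' \<in> n_paths D us vs" using P \<open>P = p # P'\<close> by (auto simp: n_paths_def)
    ultimately show "P \<in> (\<lambda>(p, P). p # P) ` (paths D u v \<times> n_paths D us vs)" by auto
  next
    fix P assume "P \<in> (\<lambda>(p, P). p # P) ` (paths D u v \<times> n_paths D us vs)"
    then show "P \<in> n_paths D (u # us) (v # vs)" by (auto simp: n_paths_def nth_Cons split: nat.splits)
  qed
  show "finite (n_paths D (u # us) (v # vs))"
    unfolding eq using Cons.IH(1) finite_paths' by simp
  have "(\<Sum>P\<in>n_paths D (u # us) (v # vs). n_path_wt x P) =
      (\<Sum>(p, P)\<in>paths D u v \<times> n_paths D us vs. path_wt x p * n_path_wt x P)"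
    unfolding eq by (subst sum.reindex) (auto simp: inj_on_def n_path_wt_def intro!: sum.cong)
  also have "\<dots> = h D x u v * (\<Sum>P\<in>n_paths D us vs. n_path_wt x P)"
    by (simp add: h_def sum_product sum.cartesian_product)
  also have "\<dots> = (\<Prod>i<length (u # us). h D x ((u # us) ! i) ((v # vs) ! i))"
    by (simp add: Cons.IH prod.lessThan_Suc_shift del: prod.lessThan_Suc)
  finally show "(\<Sum>P\<in>n_paths D (u # us) (v # vs). n_path_wt x P) =
    (\<Prod>i<length (u # us). h D x ((u # us) ! i) ((v # vs) ! i))" .
qed

end

lemma prod_lessThan_update_two:
  fixes f g :: "nat \<Rightarrow> 'r::comm_monoid_mult"
  assumes "i < m" "j < m" "i \<noteq> j" "f i * f j = g i * g j"
    and "\<And>k. k < m \<Longrightarrow> k \<noteq> i \<Longrightarrow> k \<noteq> j \<Longrightarrow> f k = g k"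
  shows "(\<Prod>k<m. f k) = (\<Prod>k<m. g k)"
proof -
  let ?R = "{..<m} - {i} - {j}"
  have split: "(\<Prod>k<m. q k) = q i * q j * (\<Prod>k\<in>?R. q k)" for q :: "nat \<Rightarrow> 'r"
  proof -
    have "(\<Prod>k<m. q k) = q i * (\<Prod>k\<in>{..<m} - {i}. q k)"
      using assms by (intro prod.remove) auto
    also have "(\<Prod>k\<in>{..<m} - {i}. q k) = q j * (\<Prod>k\<in>?R. q k)"
      using assms by (intro prod.remove) auto
    finally show ?thesis by (simp only: mult.assoc)
  qed
  have "(\<Prod>k\<in>?R. f k) = (\<Prod>k\<in>?R. g k)" using assms(5) by (intro prod.cong) auto
  then show ?thesis by (simp only: split[of f] split[of g] assms(4))
qed

section \<open>The sign-reversing exchange of initial parts\<close>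

locale path_exchange = finite_path_digraph D for D :: "('v, 'e) pre_digraph" +
  fixes u w :: "'v list" and m :: nat and x :: "'e \<Rightarrow> 'r::comm_ring_1"
  assumes lengths: "length u = m" "length w = m"
begin

definition trace :: "(nat \<Rightarrow> nat) \<times> 'e list list \<Rightarrow> nat \<Rightarrow> 'v set" where
  "trace = (\<lambda>(\<pi>, P) k. path_verts D (u ! \<pi> k) (P ! k))"

text \<open>The permutation is carried along with the paths because an exchange of initial parts
  swaps two starting points; its sign is the sign of the family.\<close>

definition families :: "((nat \<Rightarrow> nat) \<times> 'e list list) set" where
  "families = {(\<pi>, P). \<pi> permutes {..<m} \<and> length P = m \<and> (\<forall>k<m. awalk (u ! \<pi> k) (P ! k) (w ! k))}"

definition meeting :: "((nat \<Rightarrow> nat) \<times> 'e list list) set" where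
  "meeting = {R \<in> families. \<exists>k<m. \<exists>l<m. k \<noteq> l \<and> trace R k \<inter> trace R l \<noteq> {}}"

definition exchange_at :: "nat \<Rightarrow> 'v \<Rightarrow> nat \<Rightarrow> (nat \<Rightarrow> nat) \<times> 'e list list \<Rightarrow> (nat \<Rightarrow> nat) \<times> 'e list list" where
  "exchange_at i y j = (\<lambda>(\<pi>, P). (\<pi> \<circ> transpose i j,
     P[i := init_part (u ! \<pi> j) (P ! j) y @ final_part (u ! \<pi> i) (P ! i) y,
       j := init_part (u ! \<pi> i) (P ! i) y @ final_part (u ! \<pi> j) (P ! j) y]))"

definition exchange :: "(nat \<Rightarrow> nat) \<times> 'e list list \<Rightarrow> (nat \<Rightarrow> nat) \<times> 'e list list" where
  "exchange R = (let (i, y, j) = (SOME (i, y, j). crossing m (trace R) i y j) in exchange_at i y j R)"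

lemma exchange_eq:
  assumes "crossing m (trace R) i y j"
  shows "exchange R = exchange_at i y j R"
proof -
  have "(SOME (i, y, j). crossing m (trace R) i y j) = (i, y, j)"
  proof (rule some_equality)
    fix t assume t: "case t of (i', y', j') \<Rightarrow> crossing m (trace R) i' y' j'"
    obtain i' y' j' where "t = (i', y', j')" by (rule prod_cases3)
    then show "t = (i, y, j)" using crossing_unique[OF assms, of i' y' j'] t by simp
  qed (use assms in simp)
  then show ?thesis by (simp add: exchange_def)
qed

lemma meeting_crossing:
  assumes "R \<in> meeting"
  obtains i y j where "crossing m (trace R) i y j"
proof -
  obtain k l where "k < m" "l < m" "k \<noteq> l" "trace R k \<inter> trace R l \<noteq> {}"
    using assms by (auto simp: meeting_def)
  moreover have "\<exists>y\<in>M. \<forall>z\<in>M. leads_to z y" if "k < m" "M \<subseteq> trace R k" "M \<noteq> {}" for k M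
  proof -
    obtain \<pi> P where RP: "R = (\<pi>, P)" by (cases R)
    then have "awalk (u ! \<pi> k) (P ! k) (w ! k)"
      using assms that by (simp add: meeting_def families_def)
    then show ?thesis
      using that(2,3) by (intro path_verts_greatest) (simp_all add: RP trace_def)
  qed
  ultimately show ?thesis using crossing_exists[of k m l "trace R"] that by blast
qed

text \<open>Swapping two starting points composes \<open>\<pi>\<close> with a transposition, while
  the edges used are the same in total. As the crossing stays in place, repeating the exchange
  undoes it.\<close>

lemma exchange_at:
  assumes R: "R \<in> families" and cr: "crossing m (trace R) i y j"
  shows "exchange_at i y j R \<in> families"
    and "crossing m (trace (exchange_at i y j R)) i y j"
    and "exchange_at i y j (exchange_at i y j R) = R"
    and "sign (fst (exchange_at i y j R)) = - sign (fst R)"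
    and "n_path_wt x (snd (exchange_at i y j R)) = n_path_wt x (snd R)"
proof -
  obtain \<pi> P where RP: "R = (\<pi>, P)" by (cases R)
  have \<pi>: "\<pi> permutes {..<m}" and lP: "length P = m" and aw: "\<And>k. k < m \<Longrightarrow> awalk (u ! \<pi> k) (P ! k) (w ! k)"
    using R by (auto simp: RP families_def)
  have ij: "i < m" "j < m" "j \<noteq> i" "y \<in> path_verts D (u ! \<pi> i) (P ! i)" "y \<in> path_verts D (u ! \<pi> j) (P ! j)"
    using cr by (auto simp: crossing_def trace_def RP)
  define a b c d where "a = init_part (u ! \<pi> i) (P ! i) y" and "b = final_part (u ! \<pi> i) (P ! i) y"
    and "c = init_part (u ! \<pi> j) (P ! j) y" and "d = final_part (u ! \<pi> j) (P ! j) y"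
  note abcd = a_def b_def c_def d_def
  have Pi: "P ! i = a @ b" "awalk (u ! \<pi> i) a y" "awalk y b (w ! i)"
    unfolding abcd using init_final_part[OF aw[OF ij(1)] ij(4)] by auto
  have Pj: "P ! j = c @ d" "awalk (u ! \<pi> j) c y" "awalk y d (w ! j)"
    unfolding abcd using init_final_part[OF aw[OF ij(2)] ij(5)] by auto
  define P' where "P' = P[i := c @ b, j := a @ d]"
  have ex: "exchange_at i y j R = (\<pi> \<circ> transpose i j, P')"
    by (simp add: exchange_at_def RP P'_def abcd)
  have P': "P' ! i = c @ b" "P' ! j = a @ d" "length P' = m" "\<And>k. k \<noteq> i \<Longrightarrow> k \<noteq> j \<Longrightarrow> P' ! k = P ! k"
    using ij lP by (auto simp: P'_def)
  have \<pi>': "(\<pi> \<circ> transpose i j) i = \<pi> j" "(\<pi> \<circ> transpose i j) j = \<pi> i"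
    "\<And>k. k \<noteq> i \<Longrightarrow> k \<noteq> j \<Longrightarrow> (\<pi> \<circ> transpose i j) k = \<pi> k"
    by (auto simp: Transposition.transpose_def)
  have t: "transpose i j permutes {..<m}" using ij by (intro permutes_swap_id) auto
  show "exchange_at i y j R \<in> families"
  proof -
    have "awalk (u ! (\<pi> \<circ> transpose i j) k) (P' ! k) (w ! k)" if "k < m" for k
      using awalk_appendI[OF Pj(2) Pi(3)] awalk_appendI[OF Pi(2) Pj(3)] aw[OF that] \<pi>' P'
      by (cases "k = i"; cases "k = j") simp_all
    then show ?thesis
      using P'(3) permutes_compose[OF t \<pi>] unfolding ex families_def by blast
  qed
  show "crossing m (trace (exchange_at i y j R)) i y j"
  proof (rule crossing_exchange[OF cr])
    show "trace R i = path_verts D (u ! \<pi> i) a \<union> path_verts D y b"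
      "trace R j = path_verts D (u ! \<pi> j) c \<union> path_verts D y d"
      using path_verts_append[OF Pi(2,3)] path_verts_append[OF Pj(2,3)]
      by (simp_all add: RP trace_def Pi(1) Pj(1))
    show "trace (exchange_at i y j R) i = path_verts D (u ! \<pi> j) c \<union> path_verts D y b"
      "trace (exchange_at i y j R) j = path_verts D (u ! \<pi> i) a \<union> path_verts D y d"
      using path_verts_append[OF Pj(2) Pi(3)] path_verts_append[OF Pi(2) Pj(3)] \<pi>' P'
      unfolding ex by (simp_all add: trace_def)
    show "trace (exchange_at i y j R) k = trace R k" if "k \<noteq> i" "k \<noteq> j" for k
      using \<pi>'(3)[OF that] P'(4)[OF that] unfolding ex by (simp add: trace_def RP)
    show "leads_to z y" if "z \<in> path_verts D (u ! \<pi> i) a \<union> path_verts D (u ! \<pi> j) c" for z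
      using that path_verts_leads_to(2)[OF Pi(2)] path_verts_leads_to(2)[OF Pj(2)] by blast
  qed (use path_verts_ends[OF Pi(2)] path_verts_ends[OF Pj(2)] path_verts_ends[OF Pi(3)]
      path_verts_ends[OF Pj(3)] in auto)
  show "exchange_at i y j (exchange_at i y j R) = R"
  proof -
    have "P'[i := a @ b, j := c @ d] = P"
      using P' Pi(1) Pj(1) lP ij by (intro nth_equalityI) (auto simp: nth_list_update)
    moreover have "\<pi> \<circ> transpose i j \<circ> transpose i j = \<pi>" by (simp add: comp_assoc)
    moreover have "exchange_at i y j (exchange_at i y j R) =
      (\<pi> \<circ> transpose i j \<circ> transpose i j, P'[i := a @ b, j := c @ d])"
      unfolding ex unfolding exchange_at_def prod.case \<pi>' P'
        init_final_append[OF Pj(2) Pi(3)] init_final_append[OF Pi(2) Pj(3)] ..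
    ultimately show ?thesis by (simp add: RP)
  qed
  have "permutation \<pi>" using \<pi> permutation_permutes by blast
  then have "sign (\<pi> \<circ> transpose i j) = - sign \<pi>"
    using ij by (subst sign_compose) (simp_all add: sign_swap_id permutation_swap_id)
  then show "sign (fst (exchange_at i y j R)) = - sign (fst R)"
    unfolding ex by (simp add: RP)
  have wt: "n_path_wt x P = (\<Prod>k<m. path_wt x (P ! k))" if "length P = m" for P
    using that by (simp add: n_path_wt_def prod.list_conv_set_nth atLeast0LessThan)
  have "n_path_wt x P' = n_path_wt x P"
    unfolding wt[OF lP] wt[OF P'(3)] using ij P' Pi(1) Pj(1)
    by (intro prod_lessThan_update_two[of i m j]) (auto simp: path_wt_def)
  then show "n_path_wt x (snd (exchange_at i y j R)) = n_path_wt x (snd R)"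
    unfolding ex by (simp add: RP)
qed

lemma crossing_meets:
  "crossing m Q i y j \<Longrightarrow> \<exists>k<m. \<exists>l<m. k \<noteq> l \<and> Q k \<inter> Q l \<noteq> {}"
  unfolding crossing_def by blast

lemma sum_meeting: "(\<Sum>R\<in>meeting. of_int (sign (fst R)) * n_path_wt x (snd R)) = 0"
proof (rule sum_sign_reversing_involution[where \<phi> = exchange])
  fix R assume R: "R \<in> meeting"
  then obtain i y j where cr: "crossing m (trace R) i y j" by (rule meeting_crossing)
  have "R \<in> families" using R by (simp add: meeting_def)
  note ea = exchange_at[OF this cr]
  show "exchange R \<in> meeting"
    unfolding exchange_eq[OF cr] meeting_def using ea(1) crossing_meets[OF ea(2)] by blast
  show "exchange (exchange R) = R"
    unfolding exchange_eq[OF cr] exchange_eq[OF ea(2)] by (rule ea(3))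
  show "sign (fst (exchange R)) = - sign (fst R)" "n_path_wt x (snd (exchange R)) = n_path_wt x (snd R)"
    unfolding exchange_eq[OF cr] by (rule ea)+
  show "sign (fst R) = 1 \<or> sign (fst R) = - 1" by (simp add: sign_def)
qed

text \<open>The intersecting families sum to 0, so they can be added. The sum over all n-paths
  factors into path generating functions, and the signed sum is the Leibniz formula.\<close>

lemma sign_sum_F0:
  "(\<Sum>\<pi>\<in>{\<pi>. \<pi> permutes {..<m}}. of_int (sign \<pi>) * F0 D x (permute_list \<pi> u) w)
    = det (mat m m (\<lambda>(i, j). h D x (u ! i) (w ! j)))"
proof -
  let ?S = "{\<pi>. \<pi> permutes {..<m}}" and ?N = "\<lambda>\<pi>. n_paths D (permute_list \<pi> u) w"
  let ?ni = "\<lambda>\<pi>. {P \<in> ?N \<pi>. non_intersecting D (permute_list \<pi> u) P}"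
  let ?in = "\<lambda>\<pi>. {P \<in> ?N \<pi>. \<not> non_intersecting D (permute_list \<pi> u) P}"
  have fin: "finite (?N \<pi>)" for \<pi> using lengths by (intro sum_n_paths) simp
  have nth: "permute_list \<pi> u ! k = u ! \<pi> k" if "\<pi> permutes {..<m}" "k < m" for \<pi> k
    using that lengths by (simp add: permute_list_nth)
  have N: "?N \<pi> = {P. (\<pi>, P) \<in> families}" if "\<pi> permutes {..<m}" for \<pi>
    using that lengths by (auto simp: n_paths_def families_def nth paths_iff)
  have ni: "non_intersecting D (permute_list \<pi> u) P \<longleftrightarrow>
      \<not> (\<exists>k<m. \<exists>l<m. k \<noteq> l \<and> trace (\<pi>, P) k \<inter> trace (\<pi>, P) l \<noteq> {})"
    if "\<pi> permutes {..<m}" for \<pi> P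
    using that lengths by (auto simp: non_intersecting_def trace_def nth)
  have "(\<Sum>\<pi>\<in>?S. \<Sum>P\<in>?in \<pi>. of_int (sign \<pi>) * n_path_wt x P) =
    (\<Sum>R\<in>Sigma ?S ?in. of_int (sign (fst R)) * n_path_wt x (snd R))"
    using fin by (subst sum.Sigma) (auto simp: finite_permutations case_prod_unfold)
  also have "Sigma ?S ?in = meeting"
  proof (rule Set.set_eqI)
    fix R :: "(nat \<Rightarrow> nat) \<times> 'e list list"
    obtain \<pi> P where RP: "R = (\<pi>, P)" by (cases R)
    show "R \<in> Sigma ?S ?in \<longleftrightarrow> R \<in> meeting"
    proof (cases "\<pi> permutes {..<m}")
      case True
      then show ?thesis by (simp add: RP meeting_def N[OF True] ni[OF True])
    qed (simp add: RP meeting_def families_def)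
  qed
  finally have 0: "(\<Sum>\<pi>\<in>?S. \<Sum>P\<in>?in \<pi>. of_int (sign \<pi>) * n_path_wt x P) = 0"
    by (simp add: sum_meeting)
  have "(\<Sum>\<pi>\<in>?S. of_int (sign \<pi>) * F0 D x (permute_list \<pi> u) w) =
      (\<Sum>\<pi>\<in>?S. \<Sum>P\<in>?ni \<pi>. of_int (sign \<pi>) * n_path_wt x P)"
    by (simp add: F0_def sum_distrib_left)
  also have "\<dots> = (\<Sum>\<pi>\<in>?S. (\<Sum>P\<in>?ni \<pi>. of_int (sign \<pi>) * n_path_wt x P) + (\<Sum>P\<in>?in \<pi>. of_int (sign \<pi>) * n_path_wt x P))"
    by (simp add: sum.distrib 0)
  also have "\<dots> = (\<Sum>\<pi>\<in>?S. of_int (sign \<pi>) * (\<Sum>P\<in>?N \<pi>. n_path_wt x P))"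
    unfolding sum_distrib_left using fin
    by (intro sum.cong refl) (subst sum.union_disjoint[symmetric], auto intro!: sum.cong)
  also have "\<dots> = (\<Sum>\<pi>\<in>?S. of_int (sign \<pi>) * (\<Prod>i<m. h D x (u ! \<pi> i) (w ! i)))"
    using lengths by (intro sum.cong refl) (auto simp: sum_n_paths(2) nth)
  also have "\<dots> = det (mat m m (\<lambda>(i, j). h D x (u ! i) (w ! j)))"
    using permutes_in_image[of _ "{..<m}"]
    by (subst det_col[of _ m]) (auto simp: atLeast0LessThan intro!: sum.cong prod.cong)
  finally show ?thesis .
qed

end

section \<open>Translation to matrices and polynomials\<close>

lemma delete_nth_distinct:
  assumes "distinct xs" "t < length xs"
  shows "delete_nth t xs = filter (\<lambda>y. y \<noteq> xs ! t) xs"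
proof -
  define as b bs where "as = take t xs" and "b = xs ! t" and "bs = drop (Suc t) xs"
  have xs: "xs = as @ b # bs"
    unfolding as_def b_def bs_def using assms(2) by (rule id_take_nth_drop)
  have "filter (\<lambda>y. y \<noteq> b) as = as" "filter (\<lambda>y. y \<noteq> b) bs = bs"
    using assms(1) unfolding xs by (auto intro!: filter_True)
  then have "filter (\<lambda>y. y \<noteq> b) (as @ b # bs) = as @ bs" by simp
  then show ?thesis unfolding delete_nth_def as_def[symmetric] bs_def[symmetric] b_def[symmetric]
    using xs by simp
qed

locale alternating_form_nat = alternating_form w for w :: "nat \<Rightarrow> nat \<Rightarrow> 'r::comm_ring_1"
begin

text \<open>The exponent \<open>j + k + 1\<close> is \<open>Suc j + Suc k - 1\<close>, the one of
  \<open>copfaffian\<close>.\<close>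

definition copf :: "nat \<Rightarrow> nat \<Rightarrow> nat \<Rightarrow> 'r" where
  "copf N j k =
    (let c = (\<lambda>j k. (- 1) ^ (j + k + 1) * pfw w (filter (\<lambda>i. i \<noteq> j \<and> i \<noteq> k) [0..<N]))
     in if j < k then c j k else if k < j then - c k j else 0)"

text \<open>Up to sign, the sum expands along row \<open>i\<close> the Pfaffian of
  \<open>[0..<N]\<close> with the letter \<open>k\<close> replaced by \<open>i\<close>. This word
  repeats a letter if \<open>i \<noteq> k\<close> and is \<open>[0..<N]\<close> itself if
  \<open>i = k\<close>, as in the expansion of a determinant by alien cofactors.\<close>

lemma row_times_copf:
  assumes i: "i < N" and k: "k < N"
  shows "(\<Sum>j<N. w i j * copf N j k) = - (of_bool (i = k) * pfw w [0..<N])"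
proof -
  let ?o = "[0..<k] @ [Suc k..<N]"
  let ?P = "\<lambda>j. pfw w (filter (\<lambda>i. i \<noteq> j \<and> i \<noteq> k) [0..<N])"
  have split: "[0..<N] = [0..<k] @ k # [Suc k..<N]"
    using k upt_add_eq_append[of 0 k "N - k"] by (simp add: upt_conv_Cons)
  have o: "?o = filter (\<lambda>y. y \<noteq> k) [0..<N]"
    unfolding split by (auto intro!: filter_True[symmetric])
  have nth: "?o ! t = (if t < k then t else Suc t)" if "t < N - 1" for t
    using that k by (auto simp: nth_append)
  have del: "pfw w (delete_nth t ?o) = ?P (?o ! t)" if "t < N - 1" for t
  proof -
    have "delete_nth t ?o = filter (\<lambda>y. y \<noteq> ?o ! t) ?o"
      using that k by (intro delete_nth_distinct) auto
    also have "filter (\<lambda>y. y \<noteq> ?o ! t) ?o = filter (\<lambda>i. i \<noteq> ?o ! t \<and> i \<noteq> k) [0..<N]"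
      by (subst (2) o) (simp add: conj_commute)
    finally show ?thesis by simp
  qed
  have "of_bool (i = k) * pfw w [0..<N] = pfw w ([0..<k] @ i # [Suc k..<N])"
  proof (cases "i = k")
    case False
    then have "\<not> distinct ([0..<k] @ i # [Suc k..<N])" using i by auto
    then show ?thesis using False by (simp add: not_distinct)
  qed (simp add: split)
  also have "\<dots> = (- 1) ^ k * pfw w (i # ?o)"
    using move_right[of "[]" i "[0..<k]" "[Suc k..<N]"] by simp
  also have "pfw w (i # ?o) = (\<Sum>t<N - 1. (- 1) ^ t * w i (?o ! t) * pfw w (delete_nth t ?o))"
    unfolding pfw_Cons using k by simp
  also have "(- 1) ^ k * \<dots> = (\<Sum>t<N - 1. (- 1) ^ (k + t) * w i (?o ! t) * ?P (?o ! t))"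
    unfolding sum_distrib_left by (intro sum.cong refl) (simp add: del power_add mult.assoc)
  \<comment> \<open>Beyond \<open>k\<close> the position \<open>t\<close> holds the letter
    \<open>t + 1\<close>. This shift flips the sign, in step with the entry \<open>- c k j\<close>
    of \<open>copf\<close> below the diagonal.\<close>
  also have "\<dots> = (\<Sum>j\<in>{..<N} - {k}. - (w i j * copf N j k))"
  proof (rule sum.reindex_bij_witness[of _ "\<lambda>j. if j < k then j else j - 1" "\<lambda>t. if t < k then t else Suc t"])
    fix t assume "t \<in> {..<N - 1}"
    then have t: "t < N - 1" by simp
    show "- (w i (if t < k then t else Suc t) * copf N (if t < k then t else Suc t) k)
      = (- 1) ^ (k + t) * w i (?o ! t) * ?P (?o ! t)"
      unfolding nth[OF t] by (auto simp: copf_def Let_def conj_commute add.commute mult_ac)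
  qed (use k in auto)
  also have "\<dots> = - (\<Sum>j\<in>{..<N} - {k}. w i j * copf N j k)"
    by (rule sum_negf)
  also have "(\<Sum>j\<in>{..<N} - {k}. w i j * copf N j k) = (\<Sum>j<N. w i j * copf N j k)"
    using k by (intro sum.mono_neutral_left) (auto simp: copf_def)
  finally show ?thesis by simp
qed

end

text \<open>Extended by 0 beyond the matrix, so that the form is alternating on all
  naturals.\<close>

definition mat_form :: "'a::comm_ring_1 mat \<Rightarrow> nat \<Rightarrow> nat \<Rightarrow> 'a" where
  "mat_form A i j = (if i < dim_row A \<and> j < dim_row A then A $$ (i, j) else 0)"

lemma alternating_mat_form:
  assumes "skew_symmetric A"
  shows "alternating_form (mat_form A)"
proof
  have sq: "dim_col A = dim_row A" and tr: "transpose_mat A = - A"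
    and d: "\<And>i. i < dim_row A \<Longrightarrow> A $$ (i, i) = 0"
    using assms by (auto simp: skew_symmetric_def)
  show "mat_form A i i = 0" for i by (simp add: mat_form_def d)
  show "mat_form A i j = - mat_form A j i" for i j
  proof (cases "i < dim_row A \<and> j < dim_row A")
    case True
    then have "transpose_mat A $$ (j, i) = (- A) $$ (j, i)" using tr by simp
    then show ?thesis using True sq by (simp add: mat_form_def)
  qed (auto simp: mat_form_def)
qed

lemma pf_mat_form: "even (dim_row A) \<Longrightarrow> pf A = pfw (mat_form A) [0..<dim_row A]"
  by (subst pf_eq_pfw) (auto simp: mat_form_def intro!: pfw_cong)

lemma pf_submatrix_mat_form:
  assumes "A \<in> carrier_mat N N" "even (card {i. i < N \<and> i \<in> K})"
  shows "pf (submatrix A K K) = pfw (mat_form A) (filter (\<lambda>i. i \<in> K) [0..<N])"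
  unfolding pf_submatrix[OF assms] using assms(1)
  by (intro pfw_cong) (auto simp: mat_form_def)

lemma copfaffian_entry:
  assumes A: "A \<in> carrier_mat N N" "skew_symmetric A" "even N" and jk: "j < N" "k < N"
  shows "copfaffian A $$ (j, k) = alternating_form_nat.copf (mat_form A) N j k"
proof -
  interpret alternating_form_nat "mat_form A"
    using alternating_mat_form[OF A(2)] by (rule alternating_form_nat.intro)
  have "pf (submatrix A (- {j, k}) (- {j, k})) = pfw (mat_form A) (filter (\<lambda>i. i \<noteq> j \<and> i \<noteq> k) [0..<N])"
    if "j \<noteq> k" "j < N" "k < N" for j k
  proof -
    have "{i. i < N \<and> i \<in> - {j, k}} = {..<N} - {j, k}" by auto
    moreover have "card ({..<N} - {j, k}) = N - 2"
      using that by (subst card_Diff_subset) auto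
    ultimately show ?thesis
      using A by (subst pf_submatrix_mat_form[OF A(1)]) auto
  qed
  then show ?thesis
    using A jk by (auto simp: copfaffian_def copf_def Let_def)
qed

text \<open>\<open>pfw_inverse\<close> applies once the inverse \<open>B\<close> is known to be
  alternating. For \<open>T = B\<close>, the form \<open>TAT\<close> is B A times the transpose of
  B, that is, the transpose of B, and \<open>TAT\<close> is alternating because \<open>A\<close>
  is.\<close>

lemma pf_nonzero:
  fixes A :: "'k::field mat"
  assumes A: "A \<in> carrier_mat N N" "skew_symmetric A" "even N" "det A \<noteq> 0"
  shows "pf A \<noteq> 0"
proof -
  obtain B where B: "B \<in> carrier_mat N N" "B * A = 1\<^sub>m N" "A * B = 1\<^sub>m N"
    using det_non_zero_imp_unit[OF A(1,4)] by (auto simp: Units_def ring_mat_def)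
  let ?a = "mat_form A" and ?b = "mat_form B"
  interpret a: alternating_form ?a by (rule alternating_mat_form[OF A(2)])
  interpret pfaffian_alphabet ?b "\<lambda>_ _. 0" ?a ?a N
    by (rule pfaffian_alphabet.intro) (rule a.alternating_form_axioms)+
  have ent: "(X * Y) $$ (i, j) = (\<Sum>k<N. mat_form X i k * mat_form Y k j)"
    if "X \<in> carrier_mat N N" "Y \<in> carrier_mat N N" "i < N" "j < N" for X Y :: "'k mat" and i j
    using that by (auto simp: scalar_prod_def mat_form_def atLeast0LessThan intro!: sum.cong)
  have TA: "TA i l = of_bool (i = l)" if "i < N" "l < N" for i l
    unfolding TA_def using that by (simp add: ent[OF B(1) A(1) that, symmetric] B(2))
  have TAT: "TAT i j = ?b j i" if "i < N" "j < N" for i j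
  proof -
    have "TAT i j = (\<Sum>l<N. of_bool (i = l) * ?b j l)"
      unfolding TAT_def using TA[OF that(1)] by (intro sum.cong) auto
    also have "\<dots> = ?b j i" using that by (simp add: of_bool_def if_distribR if_distrib sum.delta cong: if_cong)
    finally show ?thesis .
  qed
  have "alternating_form ?b"
  proof
    show "?b i i = 0" for i
      using TAT[of i i] TAT_diag[of i] B(1) by (cases "i < N") (auto simp: mat_form_def)
    show "?b i j = - ?b j i" for i j
      using TAT[of i j] TAT[of j i] TAT_skew[of j i] B(1)
      by (cases "i < N \<and> j < N") (auto simp: mat_form_def)
  qed
  moreover have "(\<Sum>k<N. ?a i k * ?b k l) = of_bool (i = l)" if "i < N" "l < N" for i l
    using that by (simp add: ent[OF A(1) B(1) that, symmetric] B(3))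
  ultimately have "pfw ?b (rev [0..<N]) * pfw ?a [0..<N] = 1"
    using A(3) a.alternating_form_axioms by (intro pfw_inverse)
  then show ?thesis
    using A by (subst pf_mat_form) auto
qed

section \<open>Entries of the block matrix\<close>

lemma antidiag_mat_carrier [simp]:
  "antidiag_mat n \<in> carrier_mat n n" "dim_row (antidiag_mat n) = n" "dim_col (antidiag_mat n) = n"
  by (simp_all add: antidiag_mat_def)

lemma mult_antidiag_mat:
  assumes "X \<in> carrier_mat r n" "i < r" "j < n"
  shows "(X * antidiag_mat n) $$ (i, j) = X $$ (i, n - 1 - j)"
proof -
  have "(X * antidiag_mat n) $$ (i, j) = (\<Sum>k<n. X $$ (i, k) * (if k + j + 1 = n then 1 else 0))"
    using assms by (auto simp: scalar_prod_def antidiag_mat_def atLeast0LessThan intro!: sum.cong)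
  also have "\<dots> = (\<Sum>k<n. if k = n - 1 - j then X $$ (i, k) else 0)"
    using assms by (intro sum.cong) auto
  finally show ?thesis using assms by simp
qed

lemma antidiag_mat_mult:
  assumes "X \<in> carrier_mat n r" "i < n" "j < r"
  shows "(antidiag_mat n * X) $$ (i, j) = X $$ (n - 1 - i, j)"
proof -
  have "(antidiag_mat n * X) $$ (i, j) = (\<Sum>k<n. (if i + k + 1 = n then 1 else 0) * X $$ (k, j))"
    using assms by (auto simp: scalar_prod_def antidiag_mat_def atLeast0LessThan intro!: sum.cong)
  also have "\<dots> = (\<Sum>k<n. if k = n - 1 - i then X $$ (k, j) else 0)"
    using assms by (intro sum.cong) auto
  finally show ?thesis using assms by simp
qed

lemma nine_block_mat_entry:
  assumes "A11 \<in> carrier_mat m m" "A12 \<in> carrier_mat m N" "A13 \<in> carrier_mat m n"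
    and "A21 \<in> carrier_mat N m" "A22 \<in> carrier_mat N N" "A23 \<in> carrier_mat N n"
    and "A31 \<in> carrier_mat n m" "A32 \<in> carrier_mat n N" "A33 \<in> carrier_mat n n"
    and "i < m + N + n" "j < m + N + n"
  shows "nine_block_mat A11 A12 A13 A21 A22 A23 A31 A32 A33 $$ (i, j) =
    (if i < m then
       if j < m then A11 $$ (i, j) else if j < m + N then A12 $$ (i, j - m) else A13 $$ (i, j - m - N)
     else if i < m + N then
       if j < m then A21 $$ (i - m, j) else if j < m + N then A22 $$ (i - m, j - m)
       else A23 $$ (i - m, j - m - N)
     else
       if j < m then A31 $$ (i - m - N, j) else if j < m + N then A32 $$ (i - m - N, j - m)
       else A33 $$ (i - m - N, j - m - N))"
  using assms by (auto simp: nine_block_mat_def append_rows_def)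

section \<open>Coefficients as constant polynomials\<close>

lemma const_hom [simp]:
  "const 0 = 0" "const 1 = 1"
  "const (a + b) = const a + const b" "const (a * b) = const a * (const b :: ('e, 'k::comm_ring_1) mpol)"
  by (simp_all add: const_def single_add mult_single)

lemma const_uminus [simp]: "const (- a) = - (const a :: ('e, 'k::comm_ring_1) mpol)"
  by (simp add: const_def single_uminus)

lemma const_sum: "const (\<Sum>i\<in>X. f i) = (\<Sum>i\<in>X. const (f i) :: ('e, 'k::comm_ring_1) mpol)"
  by (induction X rule: infinite_finite_induct) auto

lemma const_pfw: "const (pfw w xs) = pfw (\<lambda>i j. const (w i j) :: ('e, 'k::comm_ring_1) mpol) xs"
  by (rule pfw_hom) simp_all

text \<open>As a \<open>sorted_wrt\<close> condition on the end points, compatibility passes to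
  sublists, in particular from \<open>S0\<close> followed by \<open>S\<close> to \<open>S0\<close>
  followed by a subset of \<open>S\<close>.\<close>

lemma D_compatible_altdef:
  "D_compatible D us ws \<longleftrightarrow> (\<forall>i j. i < j \<and> j < length us \<longrightarrow>
    sorted_wrt (\<lambda>a b. \<forall>p\<in>paths D (us ! i) b. \<forall>q\<in>paths D (us ! j) a.
      path_verts D (us ! i) p \<inter> path_verts D (us ! j) q \<noteq> {}) ws)"
  unfolding D_compatible_def sorted_wrt_iff_nth_less by blast

lemma D_compatible_append_filter:
  "D_compatible D us (xs @ ys) \<Longrightarrow> D_compatible D us (xs @ filter Q ys)"
  unfolding D_compatible_altdef sorted_wrt_append by (auto intro: sorted_wrt_filter)

lemma permutes_strict_mono_eq_id:
  fixes m :: nat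
  assumes p: "p permutes {..<m}" and mono: "\<And>i j. i < j \<Longrightarrow> j < m \<Longrightarrow> p i < p j"
  shows "p = id"
proof
  fix i
  have "map p [0..<m] = [0..<m]"
  proof (rule strict_sorted_equal)
    show "sorted_wrt (<) (map p [0..<m])" by (auto simp: sorted_wrt_iff_nth_less mono)
    show "set (map p [0..<m]) = set [0..<m]"
      using permutes_image[OF p] by (simp add: atLeast0LessThan)
  qed simp
  then have "p i = i" if "i < m" using that by (metis add_0 length_upt minus_nat.diff_0 nth_map nth_upt)
  then show "p i = id i" using permutes_not_in[OF p, of i] by (cases "i < m") auto
qed

text \<open>A permutation other than the identity has an inversion, and compatibility forces the two
  paths at an inversion to meet.\<close>

lemma F0_compatible_zero:
  assumes D: "D_compatible D u w" and len: "length u = m" "length w = m"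
    and p: "p permutes {..<m}" "p \<noteq> id"
  shows "F0 D x (permute_list p u) w = 0"
proof -
  obtain i j where ij: "i < j" "j < m" "\<not> p i < p j"
    using permutes_strict_mono_eq_id[OF p(1)] p(2) by blast
  have "p i \<noteq> p j" using ij permutes_inj[OF p(1)] by (auto dest: injD)
  then have lt: "p j < p i" using ij by simp
  have pm: "p i < m" "p j < m" using permutes_in_image[OF p(1)] ij by auto
  have nth: "permute_list p u ! k = u ! p k" if "k < m" for k
    using that len p by (simp add: permute_list_nth)
  have "\<not> non_intersecting D (permute_list p u) P" if "P \<in> n_paths D (permute_list p u) w" for P
  proof -
    have "P ! i \<in> paths D (u ! p i) (w ! i)" "P ! j \<in> paths D (u ! p j) (w ! j)"
      using that ij len nth by (auto simp: n_paths_def)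
    \<comment> \<open>Compatibility is applied to the starting indices \<open>p j < p i\<close> and
      the end indices \<open>i < j\<close>.\<close>
    then have "path_verts D (u ! p j) (P ! j) \<inter> path_verts D (u ! p i) (P ! i) \<noteq> {}"
      using D[unfolded D_compatible_def, rule_format, of "p j" "p i" i j "P ! j" "P ! i"] lt pm ij len
      by simp
    moreover have "path_verts D (u ! p j) (P ! j) \<inter> path_verts D (u ! p i) (P ! i) = {}"
      if "non_intersecting D (permute_list p u) P"
      using that[unfolded non_intersecting_def, rule_format, of j i] ij len nth[of i] nth[of j] by simp
    ultimately show ?thesis by blast
  qed
  then have "{P \<in> n_paths D (permute_list p u) w. non_intersecting D (permute_list p u) P} = {}"
    by auto
  then show ?thesis unfolding F0_def by (simp only: sum.empty)
qed

section \<open>Subsets of S as sets of positions\<close>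

lemma positions_image: "I \<subseteq> {..<length S} \<Longrightarrow> distinct S \<Longrightarrow> positions S ((!) S ` I) = I"
  by (auto simp: positions_def nth_eq_iff_index_eq)

lemma image_positions: "I \<subseteq> set S \<Longrightarrow> (!) S ` positions S I = I"
  by (fastforce simp: positions_def in_set_conv_nth)

lemma ordered_subset_positions:
  "ordered_subset S I = map ((!) S) (filter (\<lambda>k. k \<in> positions S I) [0..<length S])"
proof -
  have "filter ((\<lambda>v. v \<in> I) \<circ> (!) S) [0..<length S] = filter (\<lambda>k. k \<in> positions S I) [0..<length S]"
    by (rule filter_cong) (auto simp: positions_def)
  then have "filter (\<lambda>v. v \<in> I) (map ((!) S) [0..<length S]) =
      map ((!) S) (filter (\<lambda>k. k \<in> positions S I) [0..<length S])"
    by (simp only: filter_map)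
  then show ?thesis by (simp only: ordered_subset_def map_nth)
qed

lemma sum_subsets_positions:
  assumes "distinct S"
  shows "(\<Sum>I\<in>{I. I \<subseteq> set S \<and> card I = r}. f (positions S I)) =
    (\<Sum>I\<in>{I. I \<subseteq> {..<length S} \<and> card I = r}. f I)"
proof (rule sum.reindex_bij_witness[of _ "\<lambda>I. (!) S ` I" "positions S"])
  have inj: "inj_on ((!) S) {..<length S}"
    using assms by (auto simp: inj_on_def nth_eq_iff_index_eq)
  fix I assume "I \<in> {I. I \<subseteq> {..<length S} \<and> card I = r}"
  then show "(!) S ` I \<in> {I. I \<subseteq> set S \<and> card I = r}" "positions S ((!) S ` I) = I"
    using assms card_image[OF inj_on_subset[OF inj, of I]] by (auto simp: positions_image)
next
  fix I assume I: "I \<in> {I. I \<subseteq> set S \<and> card I = r}"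
  then show eq: "(!) S ` positions S I = I" by (simp add: image_positions)
  have "inj_on ((!) S) (positions S I)"
    using assms by (auto simp: inj_on_def positions_def nth_eq_iff_index_eq)
  then have "card (positions S I) = r" using I card_image eq by fastforce
  then show "positions S I \<in> {I. I \<subseteq> {..<length S} \<and> card I = r}"
    by (auto simp: positions_def)
qed simp

lemma card_positions:
  assumes "distinct S" "I \<subseteq> set S"
  shows "card (positions S I) = card I"
proof -
  have "inj_on ((!) S) (positions S I)"
    using assms by (auto simp: inj_on_def positions_def nth_eq_iff_index_eq)
  then show ?thesis using card_image image_positions[OF assms(2)] by metis
qed

lemma length_ordered_subset:
  assumes "distinct S" "I \<subseteq> set S"
  shows "length (ordered_subset S I) = card I"
proof -
  have "set (ordered_subset S I) = I" "distinct (ordered_subset S I)"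
    using assms by (auto simp: ordered_subset_def)
  then show ?thesis using distinct_card by metis
qed

theorem theorem4p4:
  fixes D :: "('v, 'e) pre_digraph"
    and m n N :: nat
    and u S0 S :: "'v list"
    and A :: "'k::field mat"
  assumes "nomulti_digraph D"
    and "acyclic_digraph D"
    and "\<And>v w. v \<in> verts D \<Longrightarrow> w \<in> verts D \<Longrightarrow> finite (paths D v w)"
    and "0 < m" and "0 < n" and "0 < N"
    and "n \<le> m" and "even (m - n)" and "even N" and "m - n \<le> N"
    and "length u = m" and "set u \<subseteq> verts D"
    and "length S0 = n" and "distinct S0" and "set S0 \<subseteq> verts D"
    and "length S = N" and "distinct S" and "set S \<subseteq> verts D"
    and "set S0 \<inter> set S = {}"
    and "A \<in> carrier_mat N N" and "skew_symmetric A" and "det A \<noteq> 0"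
  shows
    "let x = (indet :: 'e \<Rightarrow> ('e, 'k) mpol);
         HS = H D x u S;
         HS0 = H D x u S0;
         rhs = const (pf A) * pf (nine_block_mat
           (0\<^sub>m m m) (HS * antidiag_mat N) (HS0 * antidiag_mat n)
           (- (antidiag_mat N * transpose_mat HS))
             (map_mat const ((1 / pf A) \<cdot>\<^sub>m
                (antidiag_mat N * transpose_mat (copfaffian A) * antidiag_mat N)))
             (0\<^sub>m N n)
           (- (antidiag_mat n * transpose_mat HS0)) (0\<^sub>m n N) (0\<^sub>m n n))
     in (\<Sum>I\<in>{I. I \<subseteq> set S \<and> card I = m - n}.
           const (pf (submatrix A (positions S I) (positions S I))) *
           (\<Sum>\<pi>\<in>{\<pi>. \<pi> permutes {..<m}}.
              of_int (sign \<pi>) * F0 D x (permute_list \<pi> u) (S0 @ ordered_subset S I))) = rhs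
      \<and> (D_compatible D u (S0 @ S) \<longrightarrow>
         (\<Sum>I\<in>{I. I \<subseteq> set S \<and> card I = m - n}.
           const (pf (submatrix A (positions S I) (positions S I))) *
           F0 D x u (S0 @ ordered_subset S I)) = rhs)"
proof -
  interpret finite_path_digraph D
    using assms(1,2,3) by (simp add: finite_path_digraph_def finite_path_digraph_axioms_def nomulti_digraph_def)
  define x where "x = (indet :: 'e \<Rightarrow> ('e, 'k) mpol)"
  define HS where "HS = H D x u S"
  define HS0 where "HS0 = H D x u S0"
  define M where "M = nine_block_mat
    (0\<^sub>m m m) (HS * antidiag_mat N) (HS0 * antidiag_mat n)
    (- (antidiag_mat N * transpose_mat HS))
      (map_mat const ((1 / pf A) \<cdot>\<^sub>m
         (antidiag_mat N * transpose_mat (copfaffian A) * antidiag_mat N)))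
      (0\<^sub>m N n)
    (- (antidiag_mat n * transpose_mat HS0)) (0\<^sub>m n N) (0\<^sub>m n n)"
  define lhs where "lhs F = (\<Sum>I\<in>{I. I \<subseteq> set S \<and> card I = m - n}.
    const (pf (submatrix A (positions S I) (positions S I))) * (F I :: ('e, 'k) mpol))" for F
  let ?F = "\<lambda>I. \<Sum>\<pi>\<in>{\<pi>. \<pi> permutes {..<m}}.
    of_int (sign \<pi>) * F0 D x (permute_list \<pi> u) (S0 @ ordered_subset S I)"
  have [simp]: "length u = m" "length S = N" "length S0 = n" using assms by auto
  have A: "A \<in> carrier_mat N N" "skew_symmetric A" "even N" "det A \<noteq> 0" using assms by auto
  have dimA [simp]: "dim_row A = N" using A by auto
  let ?a = "mat_form A"
  interpret a: alternating_form_nat ?a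
    using alternating_mat_form[OF A(2)] by (rule alternating_form_nat.intro)
  have pfA: "pf A = pfw ?a [0..<N]" using A by (simp add: pf_mat_form)
  have nz: "pf A \<noteq> 0" by (rule pf_nonzero[OF A])
  \<comment> \<open>The transposed copfaffian matrix divided by \<open>pf A\<close> is the inverse
    of \<open>A\<close>; the transposition cancels the minus sign in
    \<open>row_times_copf\<close>.\<close>
  define C where "C k l = a.copf N l k / pf A" for k l
  have altC: "alternating_form C"
    by unfold_locales (auto simp: C_def a.copf_def Let_def)
  have inv: "(\<Sum>k<N. ?a i k * C k l) = of_bool (i = l)" if "i < N" "l < N" for i l
  proof -
    have "(\<Sum>k<N. ?a i k * C k l) = - (\<Sum>k<N. ?a i k * a.copf N k l) / pf A"
      unfolding sum_divide_distrib[symmetric] sum_negf[symmetric]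
      by (auto simp: C_def a.copf_def Let_def sum_divide_distrib intro!: sum.cong)
    then show ?thesis using nz a.row_times_copf[OF that] by (simp add: pfA)
  qed
  define T T0 where "T i k = h D x (u ! i) (S ! k)" and "T0 i j = h D x (u ! i) (S0 ! j)" for i k j
  \<comment> \<open>The inverse is found over the field, where \<open>pf A\<close> is a unit, and
    only then carried over to polynomials.\<close>
  let ?A = "\<lambda>i j. const (?a i j) :: ('e, 'k) mpol" and ?C = "\<lambda>i j. const (C i j) :: ('e, 'k) mpol"
  have alt_const: "alternating_form (\<lambda>i j. const (w i j) :: ('e, 'k) mpol)" if "alternating_form w"
    for w :: "nat \<Rightarrow> nat \<Rightarrow> 'k"
    using that unfolding alternating_form_def by (metis const_hom(1) const_uminus)
  have altA': "alternating_form ?A" and altC': "alternating_form ?C"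
    using alt_const altC a.alternating_form_axioms by blast+
  have inv': "(\<Sum>k<N. ?A i k * ?C k l) = of_bool (i = l)" if "i < N" "l < N" for i l
    using arg_cong[OF inv[OF that], of "const :: 'k \<Rightarrow> ('e, 'k) mpol"] by (simp add: const_sum of_bool_def)
  interpret P: pfaffian_alphabet T T0 ?A ?C N
    by (rule pfaffian_alphabet.intro) (rule altA' altC')+
  \<comment> \<open>The letter of each row of \<open>M\<close>. The indices of \<open>V\<close> and
    \<open>Z\<close> run downwards because the antidiagonal factors reverse rows and
    columns.\<close>
  define \<phi> where "\<phi> i = (if i < m then U i else if i < m + N then V (N - 1 - (i - m))
    else Z (n - 1 - (i - m - N)))" for i
  have dimM: "dim_row M = m + N + n"
    by (simp add: M_def nine_block_mat_def antidiag_mat_def)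
  have HS: "HS \<in> carrier_mat m N" "HS0 \<in> carrier_mat m n" by (auto simp: HS_def HS0_def H_def)
  have cop: "copfaffian A \<in> carrier_mat N N" by (simp add: copfaffian_def)
  have M: "M $$ (i, j) = P.lf (\<phi> i) (\<phi> j)" if ij: "i < m + N + n" "j < m + N + n" for i j
  proof -
    have "M $$ (i, j) = (if i < m then
       if j < m then 0 else if j < m + N then T i (N - 1 - (j - m)) else T0 i (n - 1 - (j - m - N))
     else if i < m + N then
       if j < m then - T j (N - 1 - (i - m))
       else if j < m + N then ?C (N - 1 - (i - m)) (N - 1 - (j - m)) else 0
     else if j < m then - T0 j (n - 1 - (i - m - N)) else 0)"
    proof -
      have HSJ: "(HS * antidiag_mat N) $$ (i, j) = T i (N - 1 - j)"
        and JHS: "(antidiag_mat N * transpose_mat HS) $$ (j, i) = T i (N - 1 - j)"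
        if ij: "i < m" "j < N" for i j
      proof -
        have tr: "transpose_mat HS \<in> carrier_mat N m" using HS by simp
        show "(HS * antidiag_mat N) $$ (i, j) = T i (N - 1 - j)"
          unfolding mult_antidiag_mat[OF HS(1) ij] using ij by (simp add: HS_def H_def T_def)
        show "(antidiag_mat N * transpose_mat HS) $$ (j, i) = T i (N - 1 - j)"
          unfolding antidiag_mat_mult[OF tr ij(2,1)] using ij by (simp add: HS_def H_def T_def)
      qed
      have HS0J: "(HS0 * antidiag_mat n) $$ (i, j) = T0 i (n - 1 - j)"
        and JHS0: "(antidiag_mat n * transpose_mat HS0) $$ (j, i) = T0 i (n - 1 - j)"
        if ij: "i < m" "j < n" for i j
      proof -
        have tr: "transpose_mat HS0 \<in> carrier_mat n m" using HS by simp
        show "(HS0 * antidiag_mat n) $$ (i, j) = T0 i (n - 1 - j)"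
          unfolding mult_antidiag_mat[OF HS(2) ij] using ij by (simp add: HS0_def H_def T0_def)
        show "(antidiag_mat n * transpose_mat HS0) $$ (j, i) = T0 i (n - 1 - j)"
          unfolding antidiag_mat_mult[OF tr ij(2,1)] using ij by (simp add: HS0_def H_def T0_def)
      qed
      have Ccop: "map_mat const ((1 / pf A) \<cdot>\<^sub>m (antidiag_mat N * transpose_mat (copfaffian A) * antidiag_mat N)) $$ (i, j)
        = ?C (N - 1 - i) (N - 1 - j)" if ij: "i < N" "j < N" for i j
      proof -
        have JC: "antidiag_mat N * transpose_mat (copfaffian A) \<in> carrier_mat N N"
          by (rule mult_carrier_mat[OF antidiag_mat_carrier(1)]) (use cop in simp)
        have JCJ: "antidiag_mat N * transpose_mat (copfaffian A) * antidiag_mat N \<in> carrier_mat N N"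
          by (rule mult_carrier_mat[OF JC antidiag_mat_carrier(1)])
        have "(antidiag_mat N * transpose_mat (copfaffian A) * antidiag_mat N) $$ (i, j)
          = (antidiag_mat N * transpose_mat (copfaffian A)) $$ (i, N - 1 - j)"
          by (rule mult_antidiag_mat[OF JC ij])
        also have "\<dots> = transpose_mat (copfaffian A) $$ (N - 1 - i, N - 1 - j)"
          by (rule antidiag_mat_mult[where r = N]) (use cop ij in auto)
        also have "\<dots> = a.copf N (N - 1 - j) (N - 1 - i)"
          using cop ij copfaffian_entry[OF A(1-3), of "N - 1 - j" "N - 1 - i"] by simp
        finally show ?thesis
          using JCJ ij by (simp add: C_def)
      qed
      define X12 X13 X21 X22 X31 where "X12 = HS * antidiag_mat N" and "X13 = HS0 * antidiag_mat n"
        and "X21 = antidiag_mat N * transpose_mat HS"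
        and "X22 = map_mat (const :: 'k \<Rightarrow> ('e, 'k) mpol)
          ((1 / pf A) \<cdot>\<^sub>m (antidiag_mat N * transpose_mat (copfaffian A) * antidiag_mat N))"
        and "X31 = antidiag_mat n * transpose_mat HS0"
      note X = X12_def X13_def X21_def X22_def X31_def
      have car: "X12 \<in> carrier_mat m N" "X13 \<in> carrier_mat m n" "X21 \<in> carrier_mat N m"
        "X22 \<in> carrier_mat N N" "X31 \<in> carrier_mat n m"
        using HS by (auto simp: X)
      note ent = HSJ[folded X] JHS[folded X] HS0J[folded X] JHS0[folded X] Ccop[folded X]
      have "M = nine_block_mat (0\<^sub>m m m) X12 X13 (- X21) X22 (0\<^sub>m N n) (- X31) (0\<^sub>m n N) (0\<^sub>m n n)"
        unfolding M_def X ..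
      then show ?thesis
        using ij car
        by (simp only:) (subst nine_block_mat_entry[where m = m and N = N and n = n], auto simp: ent)
    qed
    then show ?thesis using ij by (auto simp: \<phi>_def)
  qed
  have map_rev: "map f (rev [0..<r]) = map (\<lambda>i. f (r - 1 - (i - s))) [s..<s + r]" for f :: "nat \<Rightarrow> letter" and r s
    by (rule nth_equalityI) (auto simp: rev_nth)
  have \<phi>: "map \<phi> [0..<m + N + n] = map U [0..<m] @ map V (rev [0..<N]) @ map Z (rev [0..<n])"
  proof -
    have "[0..<m + N + n] = [0..<m] @ [m..<m + N] @ [m + N..<m + N + n]"
      using upt_add_eq_append[of 0 "m + N" n] upt_add_eq_append[of 0 m N] by simp
    moreover have "map \<phi> [0..<m] = map U [0..<m]" by (simp add: \<phi>_def)
    moreover have "map \<phi> [m..<m + N] = map V (rev [0..<N])"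
      unfolding map_rev[of V N m] by (simp add: \<phi>_def)
    moreover have "map \<phi> [m + N..<m + N + n] = map Z (rev [0..<n])"
      unfolding map_rev[of Z n "m + N"] by (simp add: \<phi>_def)
    ultimately show ?thesis by simp
  qed
  have pfM: "pf M = pfw P.lf (map U [0..<m] @ map V (rev [0..<N]) @ map Z (rev [0..<n]))"
  proof -
    \<comment> \<open>\<open>m + n\<close> has the parity of \<open>m - n\<close> because
      \<open>n \<le> m\<close> makes the subtraction exact.\<close>
    have "even (m + N + n)" using assms(7,8,9) by (metis even_add even_diff_nat le_add_diff_inverse2)
    then have "pf M = pfw (\<lambda>i j. P.lf (\<phi> i) (\<phi> j)) [0..<m + N + n]"
      by (subst pf_eq_pfw) (auto simp: dimM M intro!: pfw_cong)
    then show ?thesis by (simp only: pfw_map[symmetric] \<phi>)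
  qed
  have det: "?F I = det (mat m m (\<lambda>(i, j). if j < n then T0 i j
      else T i (filter (\<lambda>k. k \<in> positions S I) [0..<N] ! (j - n))))"
    if I: "I \<subseteq> set S" "card I = m - n" for I
  proof -
    let ?p = "filter (\<lambda>k. k \<in> positions S I) [0..<N]"
    have os: "ordered_subset S I = map ((!) S) ?p" by (simp add: ordered_subset_positions)
    have len: "length ?p = m - n"
      using length_ordered_subset[OF assms(17) I(1)] I(2) unfolding os by simp
    interpret E: path_exchange D u "S0 @ ordered_subset S I" m x
      by unfold_locales (use len assms(7) os in simp_all)
    have "(S0 @ ordered_subset S I) ! j = (if j < n then S0 ! j else S ! (?p ! (j - n)))" if "j < m" for j
      using that len by (simp add: nth_append os)
    then have "mat m m (\<lambda>(i, j). h D x (u ! i) ((S0 @ ordered_subset S I) ! j)) =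
      mat m m (\<lambda>(i, j). if j < n then T0 i j else T i (?p ! (j - n)))"
      by (intro eq_matI) (auto simp: T_def T0_def)
    then show ?thesis using E.sign_sum_F0 by simp
  qed
  define g where "g K = pfw ?A (filter (\<lambda>k. k \<in> K) [0..<N]) * det (mat m m (\<lambda>(i, j). if j < n then T0 i j
      else T i (filter (\<lambda>k. k \<in> K) [0..<N] ! (j - n))))" for K
  have "lhs ?F = (\<Sum>I\<in>{I. I \<subseteq> set S \<and> card I = m - n}. g (positions S I))"
    unfolding lhs_def
  proof (rule sum.cong[OF refl])
    fix I assume "I \<in> {I. I \<subseteq> set S \<and> card I = m - n}"
    then have I: "I \<subseteq> set S" "card I = m - n" by auto
    have "{i. i < N \<and> i \<in> positions S I} = positions S I" by (auto simp: positions_def)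
    then have "even (card {i. i < N \<and> i \<in> positions S I})"
      using card_positions[OF assms(17) I(1)] I(2) assms(8) by simp
    then have "const (pf (submatrix A (positions S I) (positions S I))) =
        pfw ?A (filter (\<lambda>k. k \<in> positions S I) [0..<N])"
      by (simp add: pf_submatrix_mat_form[OF A(1)] const_pfw)
    then show "const (pf (submatrix A (positions S I) (positions S I))) * ?F I = g (positions S I)"
      by (simp only: det[OF I] g_def)
  qed
  also have "\<dots> = (\<Sum>I\<in>{I. I \<subseteq> {..<N} \<and> card I = m - n}. g I)"
    using sum_subsets_positions[OF assms(17), where f = g and r = "m - n"] by simp
  also have "\<dots> = pfw ?A [0..<N] * pf M"
    unfolding g_def pfM
    by (rule pfw_inverse_minor_summation[OF altA' altC' assms(9,7,8) inv', symmetric])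
  also have "pfw ?A [0..<N] = const (pf A)" by (simp add: pfA const_pfw)
  finally have 1: "lhs ?F = const (pf A) * pf M" .
  have 2: "lhs (\<lambda>I. F0 D x u (S0 @ ordered_subset S I)) = const (pf A) * pf M"
    if comp: "D_compatible D u (S0 @ S)"
  proof -
    have "?F I = F0 D x u (S0 @ ordered_subset S I)" if I: "I \<subseteq> set S" "card I = m - n" for I
    proof -
      have D: "D_compatible D u (S0 @ ordered_subset S I)"
        unfolding ordered_subset_def by (rule D_compatible_append_filter[OF comp])
      have len: "length (S0 @ ordered_subset S I) = m"
        using length_ordered_subset[OF assms(17) I(1)] I(2) assms(7) by simp
      have "?F I = (\<Sum>\<pi>\<in>{id}. of_int (sign \<pi>) * F0 D x (permute_list \<pi> u) (S0 @ ordered_subset S I))"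
      proof (rule sum.mono_neutral_right)
        show "\<forall>\<pi>\<in>{\<pi>. \<pi> permutes {..<m}} - {id}.
            of_int (sign \<pi>) * F0 D x (permute_list \<pi> u) (S0 @ ordered_subset S I) = 0"
        proof
          fix \<pi> assume "\<pi> \<in> {\<pi>. \<pi> permutes {..<m}} - {id}"
          then have "\<pi> permutes {..<m}" "\<pi> \<noteq> id" by blast+
          then have "F0 D x (permute_list \<pi> u) (S0 @ ordered_subset S I) = 0"
            by (rule F0_compatible_zero[OF D \<open>length u = m\<close> len])
          then show "of_int (sign \<pi>) * F0 D x (permute_list \<pi> u) (S0 @ ordered_subset S I) = 0"
            by (simp only: mult_zero_right)
        qed
      qed (use permutes_id in \<open>auto simp: finite_permutations\<close>)
      then show ?thesis by simp
    qed
    then show ?thesis unfolding 1[symmetric] lhs_def by (intro sum.cong) auto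
  qed
  show ?thesis
    unfolding Let_def using 1 2 unfolding lhs_def M_def HS_def HS0_def x_def by blast
qed

end
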